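(* Let $H$ be an infinite dimensional complex Hilbert space and $T\in\mathcal{B}(H)$. Then the following are equivalent. (1) $T \in \overline{\mathcal{AN}(H)}_{+}$. (2) There exist $\alpha \geq 0$ and positive compact operators $K_1,K_2 \in \mathcal{K}(H)_+$ such that $T = \alpha I - K_1 + K_2$ with $K_1 \leq \alpha I$ and $K_1 K_2 = 0$. Moreover, in (2) one has $(T-\alpha I)^{+}=K_2$ and $(T-\alpha I)^{-}=K_1$, and hence the representation of $T$ in (2) is unique (i.e. the triple $(\alpha,K_1,K_2)$ is uniquely determined by $T$).
   Context: $\mathcal{B}(H)$ is the space of bounded linear operators on $H$ with the operator norm, $\mathcal{K}(H)$ the set of compact operators; for $\mathcal{A}\subseteq\mathcal{B}(H)$, $\overline{\mathcal{A}}$ is its operator norm closure and $\mathcal{A}_+$ is the set of positive operators in $\mathcal{A}$ (positive means self-adjoint with $\langle Tx,x\rangle\ge0$ for all $x$); $\overline{\mathcal{AN}(H)}_+$ is the set of positive operators in $\overline{\mathcal{AN}(H)}$. For self-adjoint $T_1,T_2$, $T_1\le T_2$ means $T_2-T_1$ is positive. An operator is norm attaining if its norm is attained at some unit vector of its domain. $T\in\mathcal{B}(H)$ is absolutely norm attaining (an $\mathcal{AN}$-operator) if for every nonzero closed subspace $M$ of $H$ the restriction $T|_M:M\to H$ is norm attaining; $\mathcal{AN}(H)$ is the set of such operators. For self-adjoint $S$, $|S|=(S^*S)^{1/2}$, $S^+=\frac{|S|+S}{2}$, $S^-=\frac{|S|-S}{2}$. *)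

theory Defs
  imports "HOL-Analysis.Analysis"
begin

text \<open>
  A complex Hilbert space is presented as a real Hilbert space carrying a compatible complex
  structure: the complex inner product is linear in its first argument, and its real part is the
  real inner product. So the norm and the topology are those of the complex inner product.
\<close>

class complex_hilbert = real_inner + complete_space +
  fixes scaleC :: "complex \<Rightarrow> 'a \<Rightarrow> 'a"  (infixr \<open>*\<^sub>C\<close> 75)
    and cinner :: "'a \<Rightarrow> 'a \<Rightarrow> complex"
  assumes scaleC_add_right: "c *\<^sub>C (x + y) = c *\<^sub>C x + c *\<^sub>C y"
    and scaleC_add_left: "(c + d) *\<^sub>C x = c *\<^sub>C x + d *\<^sub>C x"
    and scaleC_scaleC: "c *\<^sub>C d *\<^sub>C x = (c * d) *\<^sub>C x"
    and scaleC_of_real: "complex_of_real r *\<^sub>C x = r *\<^sub>R x"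
    and cinner_commute: "cinner x y = cnj (cinner y x)"
    and cinner_add_left: "cinner (x + y) z = cinner x z + cinner y z"
    and cinner_scaleC_left: "cinner (c *\<^sub>C x) y = c * cinner x y"
    and Re_cinner: "Re (cinner x y) = inner x y"

interpretation complex_vector:
  vector_space "scaleC :: complex \<Rightarrow> 'a \<Rightarrow> 'a::complex_hilbert"
proof
  show "1 *\<^sub>C x = x" for x :: 'a
    using scaleC_of_real[of 1 x] by simp
qed (simp_all add: scaleC_add_right scaleC_add_left scaleC_scaleC)

lemma norm_eq_sqrt_cinner: "norm x = sqrt (Re (cinner x x))"
  by (simp add: Re_cinner norm_eq_sqrt_inner)

definition infinite_dimensional :: "'a::complex_hilbert itself \<Rightarrow> bool" where
  "infinite_dimensional _ \<longleftrightarrow>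
     \<not> (\<exists>B::'a set. finite B \<and> complex_vector.span B = UNIV)"

text \<open>
  The type \<open>'a \<Rightarrow>\<^sub>L 'a\<close> consists of the bounded \<^emph>\<open>real\<close>-linear operators. The bounded
  complex-linear ones form the set below; the operator norm does not depend on the scalars, so
  the library's \<^const>\<open>closure\<close> on this type is the operator norm closure.
\<close>

definition bounded_ops :: "('a::complex_hilbert \<Rightarrow>\<^sub>L 'a) set" where
  "bounded_ops = {T. \<forall>c x. blinfun_apply T (c *\<^sub>C x) = c *\<^sub>C blinfun_apply T x}"

definition compact_ops :: "('a::complex_hilbert \<Rightarrow>\<^sub>L 'a) set" where
  "compact_ops =
     {T \<in> bounded_ops. \<forall>B. bounded B \<longrightarrow> compact (closure (blinfun_apply T ` B))}"

definition norm_attaining_on :: "('a::complex_hilbert \<Rightarrow>\<^sub>L 'a) \<Rightarrow> 'a set \<Rightarrow> bool" where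
  "norm_attaining_on T M \<longleftrightarrow>
     (\<exists>x\<in>M. norm x = 1 \<and>
        norm (blinfun_apply T x) = (SUP y\<in>{y \<in> M. norm y = 1}. norm (blinfun_apply T y)))"

definition AN_ops :: "('a::complex_hilbert \<Rightarrow>\<^sub>L 'a) set" where
  "AN_ops = {T \<in> bounded_ops. \<forall>M. complex_vector.subspace M \<and> closed M \<and> M \<noteq> {0}
     \<longrightarrow> norm_attaining_on T M}"

definition is_adjoint :: "('a::complex_hilbert \<Rightarrow>\<^sub>L 'a) \<Rightarrow> ('a \<Rightarrow>\<^sub>L 'a) \<Rightarrow> bool" where
  "is_adjoint T S \<longleftrightarrow>
     (\<forall>x y. cinner (blinfun_apply T x) y = cinner x (blinfun_apply S y))"

lemma is_adjoint_unique:
  assumes "is_adjoint T S" "is_adjoint T S'"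
  shows "S = S'"
proof (rule blinfun_eqI)
  fix y
  have "inner x (blinfun_apply S y) = inner x (blinfun_apply S' y)" for x
    using assms unfolding is_adjoint_def by (metis Re_cinner)
  then show "blinfun_apply S y = blinfun_apply S' y"
    by (metis inner_commute vector_eq_ldot)
qed

definition adj :: "('a::complex_hilbert \<Rightarrow>\<^sub>L 'a) \<Rightarrow> ('a \<Rightarrow>\<^sub>L 'a)" where
  "adj T = (THE S. is_adjoint T S)"

definition self_adjoint :: "('a::complex_hilbert \<Rightarrow>\<^sub>L 'a) \<Rightarrow> bool" where
  "self_adjoint T \<longleftrightarrow> T \<in> bounded_ops \<and> is_adjoint T T"

definition positive_op :: "('a::complex_hilbert \<Rightarrow>\<^sub>L 'a) \<Rightarrow> bool" where
  "positive_op T \<longleftrightarrow>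
     self_adjoint T \<and> (\<forall>x. cinner (blinfun_apply T x) x \<in> \<real>\<^sub>\<ge>\<^sub>0)"

definition op_le :: "('a::complex_hilbert \<Rightarrow>\<^sub>L 'a) \<Rightarrow> ('a \<Rightarrow>\<^sub>L 'a) \<Rightarrow> bool" where
  "op_le S T \<longleftrightarrow> self_adjoint S \<and> self_adjoint T \<and> positive_op (T - S)"

text \<open>A positive operator has exactly one positive square root.\<close>

definition op_sqrt :: "('a::complex_hilbert \<Rightarrow>\<^sub>L 'a) \<Rightarrow> ('a \<Rightarrow>\<^sub>L 'a)" where
  "op_sqrt P = (THE R. positive_op R \<and> R o\<^sub>L R = P)"

definition op_abs :: "('a::complex_hilbert \<Rightarrow>\<^sub>L 'a) \<Rightarrow> ('a \<Rightarrow>\<^sub>L 'a)" where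
  "op_abs S = op_sqrt (adj S o\<^sub>L S)"

definition pos_part :: "('a::complex_hilbert \<Rightarrow>\<^sub>L 'a) \<Rightarrow> ('a \<Rightarrow>\<^sub>L 'a)" where
  "pos_part S = (op_abs S + S) /\<^sub>R 2"

definition neg_part :: "('a::complex_hilbert \<Rightarrow>\<^sub>L 'a) \<Rightarrow> ('a \<Rightarrow>\<^sub>L 'a)" where
  "neg_part S = (op_abs S - S) /\<^sub>R 2"

definition compact_decomposition ::
    "('a::complex_hilbert \<Rightarrow>\<^sub>L 'a) \<Rightarrow> real \<Rightarrow> ('a \<Rightarrow>\<^sub>L 'a) \<Rightarrow> ('a \<Rightarrow>\<^sub>L 'a) \<Rightarrow> bool" where
  "compact_decomposition T \<alpha> K\<^sub>1 K\<^sub>2 \<longleftrightarrow>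
     \<alpha> \<ge> 0 \<and>
     K\<^sub>1 \<in> compact_ops \<and> positive_op K\<^sub>1 \<and>
     K\<^sub>2 \<in> compact_ops \<and> positive_op K\<^sub>2 \<and>
     T = \<alpha> *\<^sub>R id_blinfun - K\<^sub>1 + K\<^sub>2 \<and>
     op_le K\<^sub>1 (\<alpha> *\<^sub>R id_blinfun) \<and>
     K\<^sub>1 o\<^sub>L K\<^sub>2 = 0"

end

theory Submission
  imports Defs
begin

text \<open>
  For a bounded operator $S$ let $\alpha$ be the infimum over finite-codimensional subspaces of
  $\sup \|Sx\|^2$. If $S$ is absolutely norm attaining, then $\|Sx\|^2 \ge \alpha - \varepsilon$
  on the unit sphere of some finite-codimensional subspace, since otherwise a closed subspace without
  a maximising vector can be built from orthonormal vectors with orthogonal images. This property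
  survives operator norm limits; for a positive limit $T$ it makes $T^2 - \alpha I$ and hence
  $T - \sqrt{\alpha} I$ compact, and the latter splits along its positive eigenspaces.
  Conversely, replacing $K_1$ by a nearby finite-rank $K_1 P$ gives $\alpha I - K_1 P + K_2$. Here a
  maximising sequence on a closed subspace $M$ converges by compactness if the supremum of
  $\|\cdot\|^2$ differs from $\alpha^2$. Otherwise that value is attained on $M \cap \ker P$,
  or $M$ is finite dimensional.
\<close>

section \<open>The complex inner product and orthogonal projections\<close>

text \<open>The passage to a finite-rank \<open>K1 P\<close> is forced: if K1 is injective and
  \<alpha> > 0, then \<alpha> I - K1 has norm \<alpha> without attaining it, so it lies only in the
  closure. In the other direction, squared norms are used because they are quadratic forms, and this
  is why a statement about T^2 precedes the one about T. With s the root of the essential value, T^2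
  - s^2 I is the product of T + s I and T - s I, and positivity of T bounds the first factor below
  when s > 0. One device serves throughout: maximise a real quadratic form on a closed subspace and
  use the first-order condition at a maximiser. It yields eigenvectors, uniqueness of positive roots
  and the attainment of norms. Infinite dimension puts a unit vector into every subspace of finite
  codimension; this bounds the essential value below and makes \<alpha> unique.\<close>

lemma cinner_add_right: "cinner x (y + z) = cinner x y + cinner x z"
  by (metis cinner_add_left cinner_commute complex_cnj_add)

lemma cinner_scaleC_right: "cinner x (c *\<^sub>C y) = cnj c * cinner x y"
  by (metis cinner_scaleC_left cinner_commute complex_cnj_mult)

lemma Im_cinner: "Im (cinner x y) = inner x (\<i> *\<^sub>C y)"
  using Re_cinner[of x "\<i> *\<^sub>C y"] by (simp add: cinner_scaleC_right)

lemma cinner_self: "cinner x x = complex_of_real ((norm x)\<^sup>2)"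
proof (rule complex_eqI)
  show "Im (cinner x x) = Im (complex_of_real ((norm x)\<^sup>2))"
    using arg_cong[OF cinner_commute[of x x], of Im] by simp
qed (simp add: Re_cinner power2_norm_eq_inner)

lemma norm_scaleC: "norm (c *\<^sub>C x) = cmod c * norm x"
proof -
  have "complex_of_real ((norm (c *\<^sub>C x))\<^sup>2) = (c * cnj c) * complex_of_real ((norm x)\<^sup>2)"
    unfolding cinner_self[symmetric] by (simp add: cinner_scaleC_left cinner_scaleC_right)
  then have "complex_of_real ((norm (c *\<^sub>C x))\<^sup>2) = complex_of_real ((cmod c * norm x)\<^sup>2)"
    by (simp only: complex_norm_square[symmetric] of_real_mult of_real_power power_mult_distrib)
  then show ?thesis
    by (metis of_real_eq_iff power2_eq_iff_nonneg norm_ge_zero mult_nonneg_nonneg)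
qed

text \<open>The real Cauchy-Schwarz inequality bounds the real and the imaginary part separately.
  The crude factor 2 suffices for a bounded bilinear form.\<close>

lemma cmod_cinner_le: "cmod (cinner x y) \<le> norm x * norm y * 2"
proof -
  have "\<bar>Re (cinner x y)\<bar> \<le> norm x * norm y" "\<bar>Im (cinner x y)\<bar> \<le> norm x * norm y"
    using Cauchy_Schwarz_ineq2[of x y] Cauchy_Schwarz_ineq2[of x "\<i> *\<^sub>C y"]
    by (simp_all add: Re_cinner Im_cinner norm_scaleC)
  then show ?thesis using cmod_le[of "cinner x y"] by linarith
qed

interpretation cinner: bounded_bilinear "cinner :: 'a::complex_hilbert \<Rightarrow> 'a \<Rightarrow> complex"
proof
  fix x y :: 'a and r :: real
  show "cinner (r *\<^sub>R x) y = r *\<^sub>R cinner x y"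
    by (simp add: scaleC_of_real[symmetric] cinner_scaleC_left scaleR_conv_of_real)
  show "cinner x (r *\<^sub>R y) = r *\<^sub>R cinner x y"
    by (simp add: scaleC_of_real[symmetric] cinner_scaleC_right scaleR_conv_of_real)
  show "\<exists>K. \<forall>x y::'a. norm (cinner x y) \<le> norm x * norm y * K"
    using cmod_cinner_le by blast
qed (simp_all add: cinner_add_left cinner_add_right)

declare cinner.zero_left [simp] cinner.zero_right [simp]

lemma cinner_eq_zero_commute: "cinner x y = 0 \<longleftrightarrow> cinner y x = 0"
  by (metis cinner_commute complex_cnj_zero)

lemma bounded_linear_scaleC: "bounded_linear (\<lambda>x. c *\<^sub>C x)"
proof (rule bounded_linear_intro[of _ "cmod c"])
  show "c *\<^sub>C (r *\<^sub>R x) = r *\<^sub>R (c *\<^sub>C x)" for r and x :: 'a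
    by (simp add: scaleC_of_real[symmetric] scaleC_scaleC mult.commute)
qed (auto simp: scaleC_add_right norm_scaleC mult.commute)

text \<open>For finite \<open>F\<close> these are exactly the closed complex subspaces of finite
  codimension. Keeping the set of constraints lets two such subspaces be intersected by a union of
  constraints.\<close>

definition perp :: "'a::complex_hilbert set \<Rightarrow> 'a set" where
  "perp F = {x. \<forall>f\<in>F. cinner x f = 0}"

lemma csubspace_perp: "complex_vector.subspace (perp F)"
  by (auto simp: complex_vector.subspace_def perp_def cinner_add_left cinner_scaleC_left)

lemma closed_perp: "closed (perp F)"
proof -
  have "perp F = (\<Inter>f\<in>F. {x. cinner x f = 0})" by (auto simp: perp_def)
  then show ?thesis
    by (auto intro!: closed_INT closed_Collect_eq continuous_intros
        linear_continuous_on cinner.bounded_linear_left)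
qed

lemma perp_anti_mono: "F \<subseteq> G \<Longrightarrow> perp G \<subseteq> perp F"
  by (auto simp: perp_def)

lemma csubspace_imp_subspace: "complex_vector.subspace N \<Longrightarrow> subspace N"
  unfolding complex_vector.subspace_def subspace_def by (metis scaleC_of_real)

text \<open>A complex subspace contains i y along with y, and the real inner product with i y is the
  imaginary part of the complex one.\<close>

lemma perpI_inner:
  assumes "complex_vector.subspace N" "\<And>y. y \<in> N \<Longrightarrow> inner x y = 0"
  shows "x \<in> perp N"
  using assms unfolding perp_def complex_vector.subspace_def
  by (auto simp: complex_eq_iff Re_cinner Im_cinner)

lemma perp_self_zero: "x \<in> N \<Longrightarrow> x \<in> perp N \<Longrightarrow> x = 0"
  by (auto simp: perp_def cinner_self)

text \<open>The minimising sequence is Cauchy by the parallelogram law.\<close>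

lemma projection_exists:
  fixes N :: "'a::complex_hilbert set"
  assumes N: "complex_vector.subspace N" "closed N"
  shows "\<exists>y\<in>N. x - y \<in> perp N"
proof -
  have sN: "subspace N" using N(1) by (rule csubspace_imp_subspace)
  define d where "d = Inf ((\<lambda>y. (norm (x - y))\<^sup>2) ` N)"
  have bb: "bdd_below ((\<lambda>y. (norm (x - y))\<^sup>2) ` N)" by (rule bdd_belowI[of _ 0]) auto
  have ne: "(\<lambda>y. (norm (x - y))\<^sup>2) ` N \<noteq> {}" using subspace_0[OF sN] by auto
  have d_le: "d \<le> (norm (x - y))\<^sup>2" if "y \<in> N" for y
    unfolding d_def using that by (intro cInf_lower bb) auto
  have "\<exists>y\<in>N. (norm (x - y))\<^sup>2 < d + inverse (real (Suc n))" for n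
    using cInf_lessD[OF ne, of "d + inverse (real (Suc n))"] unfolding d_def by auto
  then obtain y where yN: "\<And>n. y n \<in> N"
    and y: "\<And>n. (norm (x - y n))\<^sup>2 < d + inverse (real (Suc n))" by metis
  have par: "(norm (y m - y n))\<^sup>2 \<le> 2 * inverse (real (Suc m)) + 2 * inverse (real (Suc n))" for m n
  proof -
    have "(1/2) *\<^sub>R (y m + y n) \<in> N" using yN sN by (simp add: subspace_add subspace_scale)
    from d_le[OF this] have "4 * d \<le> (norm ((x - y m) + (x - y n)))\<^sup>2"
    proof -
      have "(x - y m) + (x - y n) = 2 *\<^sub>R (x - (1/2) *\<^sub>R (y m + y n))"
        by (simp add: algebra_simps scaleR_2)
      then have "norm ((x - y m) + (x - y n)) = 2 * norm (x - (1/2) *\<^sub>R (y m + y n))"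
        by (metis abs_numeral norm_scaleR)
      then show ?thesis using d_le[OF \<open>(1/2) *\<^sub>R (y m + y n) \<in> N\<close>] by (simp add: power2_eq_square)
    qed
    moreover have "(norm ((x - y m) + (x - y n)))\<^sup>2 + (norm ((x - y n) - (x - y m)))\<^sup>2
       = 2 * (norm (x - y m))\<^sup>2 + 2 * (norm (x - y n))\<^sup>2"
      by (simp add: power2_norm_eq_inner algebra_simps inner_commute)
    ultimately show ?thesis using y[of m] y[of n] by (simp add: algebra_simps)
  qed
  have "Cauchy y"
  proof (rule metric_CauchyI)
    fix e :: real assume e: "e > 0"
    obtain M where M: "inverse (real (Suc M)) < e\<^sup>2 / 4"
      using reals_Archimedean[of "e\<^sup>2 / 4"] e by auto
    have "dist (y m) (y n) < e" if "m \<ge> M" "n \<ge> M" for m n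
    proof -
      have "inverse (real (Suc m)) \<le> inverse (real (Suc M))"
        "inverse (real (Suc n)) \<le> inverse (real (Suc M))" using that by (auto simp: field_simps)
      then have "(norm (y m - y n))\<^sup>2 < e\<^sup>2" using par[of m n] M by linarith
      then show ?thesis using e by (simp add: dist_norm power_less_imp_less_base)
    qed
    then show "\<exists>M. \<forall>m\<ge>M. \<forall>n\<ge>M. dist (y m) (y n) < e" by blast
  qed
  then obtain l where l: "y \<longlonglongrightarrow> l" using Cauchy_convergent_iff convergent_def by blast
  have lN: "l \<in> N" using closed_sequentially[OF N(2)] yN l by blast
  have lim: "(norm (x - l))\<^sup>2 \<le> d"
  proof (rule tendsto_le[OF sequentially_bot])
    show "(\<lambda>n. (norm (x - y n))\<^sup>2) \<longlonglongrightarrow> (norm (x - l))\<^sup>2" by (intro tendsto_intros l)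
    show "(\<lambda>n. d + inverse (real (Suc n))) \<longlonglongrightarrow> d"
      using tendsto_add[OF tendsto_const LIMSEQ_inverse_real_of_nat] by auto
  qed (use y in \<open>auto intro!: always_eventually less_imp_le simp del: of_nat_Suc\<close>)
  have "inner (x - l) v = 0" if v: "v \<in> N" for v
  proof (rule ccontr)
    assume nz: "inner (x - l) v \<noteq> 0"
    then have vv: "inner v v > 0" by auto
    define t where "t = inner (x - l) v / inner v v"
    have "l + t *\<^sub>R v \<in> N" using lN v sN by (simp add: subspace_add subspace_scale)
    then have "(norm (x - l))\<^sup>2 \<le> (norm (x - (l + t *\<^sub>R v)))\<^sup>2" using d_le lim order_trans by blast
    also have "\<dots> = (norm (x - l))\<^sup>2 - 2 * t * inner (x - l) v + t\<^sup>2 * inner v v"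
      unfolding power2_norm_eq_inner by (simp add: algebra_simps inner_commute power2_eq_square)
    also have "\<dots> = (norm (x - l))\<^sup>2 - (inner (x - l) v)\<^sup>2 / inner v v"
      using vv by (simp add: t_def power2_eq_square)
    finally have "(inner (x - l) v)\<^sup>2 / inner v v \<le> 0" by simp
    then show False using nz vv by (simp add: divide_le_0_iff)
  qed
  then show ?thesis using lN perpI_inner[OF N(1)] by blast
qed

text \<open>Riesz representation of the functional $x \mapsto \langle Sx, z\rangle$.\<close>

lemma adjoint_vector_exists:
  assumes "S \<in> bounded_ops"
  shows "\<exists>w. \<forall>x. cinner (blinfun_apply S x) z = cinner x w"
proof -
  define f where "f x = cinner (blinfun_apply S x) z" for x
  have f_add: "f (x + y) = f x + f y" and f_scale: "f (c *\<^sub>C x) = c * f x" for x y c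
    using assms by (simp_all add: f_def bounded_ops_def blinfun.add_right cinner_add_left cinner_scaleC_left)
  have f0: "f 0 = 0" by (simp add: f_def)
  define N where "N = {x. f x = 0}"
  have N: "complex_vector.subspace N"
    using f0 by (simp add: N_def complex_vector.subspace_def f_add f_scale)
  have "closed N" unfolding N_def f_def
    by (intro closed_Collect_eq continuous_intros linear_continuous_on
        bounded_linear_compose[OF cinner.bounded_linear_left] blinfun.bounded_linear_right)
  show ?thesis
  proof (cases "N = UNIV")
    case True
    then show ?thesis by (intro exI[of _ 0]) (auto simp: N_def f_def)
  next
    case False
    then obtain u where u: "f u \<noteq> 0" by (auto simp: N_def)
    obtain p where p: "p \<in> N" "u - p \<in> perp N" using projection_exists[OF N \<open>closed N\<close>] by blast
    define y where "y = u - p"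
    have "f u = f y + f p" using f_add[of y p] by (simp add: y_def)
    then have fy: "f y \<noteq> 0" using u p by (simp add: N_def)
    then have ny: "norm y \<noteq> 0" using f0 by auto
    have "cinner x ((cnj (f y) / complex_of_real ((norm y)\<^sup>2)) *\<^sub>C y) = f x" for x
    proof -
      have "f (x - (f x / f y) *\<^sub>C y) + f ((f x / f y) *\<^sub>C y) = f x"
        by (simp add: f_add[symmetric])
      then have "x - (f x / f y) *\<^sub>C y \<in> N" using fy by (simp add: N_def f_scale)
      then have "cinner y (x - (f x / f y) *\<^sub>C y) = 0" using p by (simp add: perp_def y_def)
      then have "cinner (x - (f x / f y) *\<^sub>C y) y = 0" by (rule cinner_eq_zero_commute[THEN iffD1])
      then have "cinner x y = (f x / f y) * complex_of_real ((norm y)\<^sup>2)"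
        by (simp add: cinner.diff_left cinner_scaleC_left cinner_self)
      then show ?thesis using fy ny by (simp add: cinner_scaleC_right)
    qed
    then show ?thesis unfolding f_def by metis
  qed
qed

section \<open>Compact operators\<close>

text \<open>Points of the closure are replaced by points of \<open>S\<close> at distance below
  1/(n+1), so subsequences need only be found for sequences in \<open>S\<close> itself.\<close>

lemma compact_closure_iff_sequences:
  fixes S :: "'a::metric_space set"
  shows "compact (closure S) \<longleftrightarrow>
    (\<forall>y::nat \<Rightarrow> 'a. (\<forall>n. y n \<in> S) \<longrightarrow> (\<exists>r. strict_mono r \<and> convergent (y \<circ> r)))"
    (is "_ \<longleftrightarrow> ?R")
proof
  assume c: "compact (closure S)"
  show ?R
  proof (intro allI impI)
    fix y :: "nat \<Rightarrow> 'a" assume "\<forall>n. y n \<in> S"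
    then have "\<forall>n. y n \<in> closure S" using closure_subset by blast
    then show "\<exists>r. strict_mono r \<and> convergent (y \<circ> r)"
      using seq_compactE[of "closure S" y] c
      unfolding compact_eq_seq_compact_metric convergent_def by metis
  qed
next
  assume R: ?R
  have "\<exists>l\<in>closure S. \<exists>r. strict_mono r \<and> (y \<circ> r) \<longlonglongrightarrow> l" if y: "\<forall>n. y n \<in> closure S"
    for y :: "nat \<Rightarrow> 'a"
  proof -
    have "\<exists>s\<in>S. dist s (y n) < inverse (real (Suc n))" for n
      using y closure_approachable[of "y n" S] by auto
    then obtain s where s: "\<And>n. s n \<in> S" "\<And>n. dist (s n) (y n) < inverse (real (Suc n))" by metis
    obtain r l where r: "strict_mono r" "(s \<circ> r) \<longlonglongrightarrow> l"
      using R[rule_format, of s] s(1) unfolding convergent_def by blast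
    have "(\<lambda>n. dist (s n) (y n)) \<longlonglongrightarrow> 0"
      by (rule tendsto_sandwich[OF _ _ tendsto_const LIMSEQ_inverse_real_of_nat])
        (use s(2) in \<open>auto intro!: always_eventually less_imp_le simp del: of_nat_Suc\<close>)
    then have "(\<lambda>n. dist (s (r n)) (y (r n))) \<longlonglongrightarrow> 0"
      using LIMSEQ_subseq_LIMSEQ[OF _ r(1)] by (fastforce simp: o_def)
    moreover have "(\<lambda>n. dist (s (r n)) l) \<longlonglongrightarrow> 0"
      using tendsto_dist_iff[THEN iffD1, OF r(2)] by (simp add: o_def)
    ultimately have sum0: "(\<lambda>n. dist (s (r n)) (y (r n)) + dist (s (r n)) l) \<longlonglongrightarrow> 0"
      using tendsto_add by fastforce
    have "(\<lambda>n. dist (y (r n)) l) \<longlonglongrightarrow> 0"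
      by (rule Lim_null_comparison[OF _ sum0])
        (auto intro!: always_eventually dist_triangle3)
    then have "(y \<circ> r) \<longlonglongrightarrow> l"
      unfolding o_def by (rule tendsto_dist_iff[THEN iffD2])
    moreover have "l \<in> closure S" using r(2) s(1) unfolding closure_sequential
      by (intro exI[of _ "s \<circ> r"]) auto
    ultimately show ?thesis using r(1) by blast
  qed
  then show "compact (closure S)"
    unfolding compact_eq_seq_compact_metric by (intro seq_compactI) blast
qed

lemma compact_ops_iff_sequences:
  "K \<in> compact_ops \<longleftrightarrow> K \<in> bounded_ops \<and>
    (\<forall>x::nat \<Rightarrow> 'a::complex_hilbert. Bseq x \<longrightarrow>
      (\<exists>r. strict_mono r \<and> convergent (\<lambda>n. blinfun_apply K (x (r n)))))"
proof -
  have "(\<forall>B. bounded B \<longrightarrow> compact (closure (blinfun_apply K ` B))) \<longleftrightarrow>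
    (\<forall>x::nat \<Rightarrow> 'a. Bseq x \<longrightarrow>
      (\<exists>r. strict_mono r \<and> convergent (\<lambda>n. blinfun_apply K (x (r n)))))" (is "?L \<longleftrightarrow> ?R")
  proof
    assume ?L
    show ?R
    proof (intro allI impI)
      fix x :: "nat \<Rightarrow> 'a" assume "Bseq x"
      then have "compact (closure (blinfun_apply K ` range x))"
        using \<open>?L\<close> Bseq_eq_bounded by blast
      then have "\<forall>y::nat \<Rightarrow> 'a. (\<forall>n. y n \<in> blinfun_apply K ` range x) \<longrightarrow>
          (\<exists>r. strict_mono r \<and> convergent (y \<circ> r))"
        by (simp only: compact_closure_iff_sequences)
      from this[rule_format, of "\<lambda>n. blinfun_apply K (x n)"]
      show "\<exists>r. strict_mono r \<and> convergent (\<lambda>n. blinfun_apply K (x (r n)))"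
        by (simp add: o_def)
    qed
  next
    assume ?R
    show ?L
    proof (intro allI impI)
      fix B :: "'a set" assume B: "bounded B"
      show "compact (closure (blinfun_apply K ` B))"
        unfolding compact_closure_iff_sequences
      proof (intro allI impI)
        fix y assume y: "\<forall>n::nat. y n \<in> blinfun_apply K ` B"
        have "\<exists>x. x \<in> B \<and> y n = blinfun_apply K x" for n using y[rule_format, of n] by auto
        then obtain x where x: "\<And>n. x n \<in> B" "\<And>n. y n = blinfun_apply K (x n)" by metis
        have "Bseq x" unfolding Bseq_eq_bounded
          using B by (rule bounded_subset) (use x in auto)
        then show "\<exists>r. strict_mono r \<and> convergent (y \<circ> r)"
          using \<open>?R\<close>[rule_format, of x] by (simp add: x(2) o_def)
      qed
    qed
  qed
  then show ?thesis by (simp add: compact_ops_def)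
qed

lemma scaleC_scaleR_commute: "c *\<^sub>C (r *\<^sub>R x) = r *\<^sub>R (c *\<^sub>C x)"
  using bounded_linear_scaleC by (rule linear_scale[OF bounded_linear.linear])

lemma scaleC_minus_right: "c *\<^sub>C (- x) = - (c *\<^sub>C x)"
  using scaleC_scaleR_commute[of c "-1" x] by simp

lemma scaleC_diff_right: "c *\<^sub>C (x - y) = c *\<^sub>C x - c *\<^sub>C y"
  using scaleC_add_right[of c x "- y"] by (simp add: scaleC_minus_right)

lemma bounded_ops_simps [simp]:
  "id_blinfun \<in> bounded_ops" "0 \<in> bounded_ops"
  "S \<in> bounded_ops \<Longrightarrow> T \<in> bounded_ops \<Longrightarrow> S + T \<in> bounded_ops"
  "S \<in> bounded_ops \<Longrightarrow> T \<in> bounded_ops \<Longrightarrow> S - T \<in> bounded_ops"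
  "T \<in> bounded_ops \<Longrightarrow> - T \<in> bounded_ops"
  "T \<in> bounded_ops \<Longrightarrow> r *\<^sub>R T \<in> bounded_ops"
  "S \<in> bounded_ops \<Longrightarrow> T \<in> bounded_ops \<Longrightarrow> S o\<^sub>L T \<in> bounded_ops"
  by (auto simp: bounded_ops_def blinfun.bilinear_simps scaleC_add_right scaleC_diff_right
      scaleC_minus_right scaleC_scaleR_commute)

lemma compact_ops_bounded_ops: "K \<in> compact_ops \<Longrightarrow> K \<in> bounded_ops"
  by (simp add: compact_ops_def)

lemma compact_opsD:
  assumes "K \<in> compact_ops" "Bseq x"
  obtains r where "strict_mono r" "convergent (\<lambda>n. blinfun_apply K (x (r n)))"
  using assms compact_ops_iff_sequences by blast

lemma Bseq_bounded_linear: "bounded_linear f \<Longrightarrow> Bseq x \<Longrightarrow> Bseq (\<lambda>n. f (x n))"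
  unfolding Bseq_eq_bounded using bounded_linear_image[of "range x" f] by (simp add: image_image)

lemma Bseq_blinfun: "Bseq x \<Longrightarrow> Bseq (\<lambda>n. blinfun_apply T (x n))"
  by (rule Bseq_bounded_linear[OF blinfun.bounded_linear_right])

lemma compact_ops_add:
  assumes "K \<in> compact_ops" "L \<in> compact_ops"
  shows "K + L \<in> compact_ops"
  unfolding compact_ops_iff_sequences
proof (intro conjI allI impI)
  fix x :: "nat \<Rightarrow> 'a" assume x: "Bseq x"
  obtain r where r: "strict_mono r" "convergent (\<lambda>n. blinfun_apply K (x (r n)))"
    using compact_opsD[OF assms(1) x] .
  obtain s where s: "strict_mono s" "convergent (\<lambda>n. blinfun_apply L (x (r (s n))))"
    using compact_opsD[OF assms(2) Bseq_subseq[OF x, of r]] .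
  have "convergent (\<lambda>n. blinfun_apply K (x (r (s n))))"
    using convergent_subseq_convergent[OF r(2) s(1)] by (simp add: o_def)
  then have "convergent (\<lambda>n. blinfun_apply (K + L) (x ((r \<circ> s) n)))"
    using convergent_add[OF _ s(2)] by (simp add: blinfun.add_left)
  then show "\<exists>r. strict_mono r \<and> convergent (\<lambda>n. blinfun_apply (K + L) (x (r n)))"
    using strict_mono_o[OF r(1) s(1)] by blast
qed (use assms in \<open>simp add: compact_ops_bounded_ops\<close>)

lemma compact_ops_compose_left:
  assumes "K \<in> compact_ops" "T \<in> bounded_ops"
  shows "T o\<^sub>L K \<in> compact_ops"
  unfolding compact_ops_iff_sequences
proof (intro conjI allI impI)
  fix x :: "nat \<Rightarrow> 'a" assume x: "Bseq x"
  obtain r where r: "strict_mono r" "convergent (\<lambda>n. blinfun_apply K (x (r n)))"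
    using compact_opsD[OF assms(1) x] .
  obtain l where "(\<lambda>n. blinfun_apply K (x (r n))) \<longlonglongrightarrow> l"
    using r(2) by (auto simp: convergent_def)
  then have "(\<lambda>n. blinfun_apply (T o\<^sub>L K) (x (r n))) \<longlonglongrightarrow> blinfun_apply T l"
    by (simp add: blinfun.tendsto[OF tendsto_const])
  then show "\<exists>r. strict_mono r \<and> convergent (\<lambda>n. blinfun_apply (T o\<^sub>L K) (x (r n)))"
    using r(1) unfolding convergent_def by blast
qed (use assms in \<open>simp add: compact_ops_bounded_ops\<close>)

lemma compact_ops_compose_right:
  assumes "K \<in> compact_ops" "T \<in> bounded_ops"
  shows "K o\<^sub>L T \<in> compact_ops"
  unfolding compact_ops_iff_sequences
proof (intro conjI allI impI)
  fix x :: "nat \<Rightarrow> 'a" assume x: "Bseq x"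
  obtain r where "strict_mono r" "convergent (\<lambda>n. blinfun_apply K (blinfun_apply T (x (r n))))"
    using compact_opsD[OF assms(1) Bseq_blinfun[OF x, of T]] .
  then show "\<exists>r. strict_mono r \<and> convergent (\<lambda>n. blinfun_apply (K o\<^sub>L T) (x (r n)))"
    by (intro exI[of _ r]) simp
qed (use assms in \<open>simp add: compact_ops_bounded_ops\<close>)

lemma compact_ops_scaleR:
  assumes "K \<in> compact_ops"
  shows "r *\<^sub>R K \<in> compact_ops"
proof -
  have "r *\<^sub>R K = (r *\<^sub>R id_blinfun) o\<^sub>L K"
    by (rule blinfun_eqI) (simp add: blinfun.bilinear_simps)
  then show ?thesis using compact_ops_compose_left[OF assms] by simp
qed

lemma compact_ops_diff: "K \<in> compact_ops \<Longrightarrow> L \<in> compact_ops \<Longrightarrow> K - L \<in> compact_ops"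
  using compact_ops_add[of K "(-1) *\<^sub>R L"] compact_ops_scaleR[of L "-1"] by simp

lemma zero_compact_op: "0 \<in> compact_ops"
proof -
  have "\<exists>r::nat \<Rightarrow> nat. strict_mono r" using strict_mono_id by blast
  then show ?thesis by (simp add: compact_ops_iff_sequences convergent_const)
qed

text \<open>Applied to differences from a bounded sequence, the bound turns Cauchy
  \<open>P\<close>-images into Cauchy \<open>R\<close>-images. It serves to descend from a square to
  a root, where \<open>R\<close> enters squared and \<open>P\<close> linearly.\<close>

lemma compact_op_if_dominated:
  assumes P: "P \<in> compact_ops" and R: "R \<in> bounded_ops"
    and dom: "\<And>x. (norm (blinfun_apply R x))\<^sup>2 \<le> c * norm (blinfun_apply P x) * norm x"
  shows "R \<in> compact_ops"
  unfolding compact_ops_iff_sequences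
proof (intro conjI allI impI R)
  fix x :: "nat \<Rightarrow> 'a" assume x: "Bseq x"
  obtain B where B: "B > 0" "\<And>n. norm (x n) \<le> B" using x by (auto simp: Bseq_def)
  obtain r where r: "strict_mono r" "convergent (\<lambda>n. blinfun_apply P (x (r n)))"
    using compact_opsD[OF P x] .
  have "Cauchy (\<lambda>n. blinfun_apply R (x (r n)))"
  proof (rule metric_CauchyI)
    fix e :: real assume e: "e > 0"
    \<comment> \<open>Differences have norm at most \<open>2 * B\<close>, so this \<open>d\<close>
      makes the final bound \<open>e\<^sup>2\<close>; adding 1 to \<open>\<bar>c\<bar>\<close> keeps
      the denominator positive and the inequality strict.\<close>
    define d where "d = e\<^sup>2 / ((\<bar>c\<bar> + 1) * (2 * B))"
    have "d > 0" using e B by (simp add: d_def)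
    then obtain M where M: "\<And>m n. m \<ge> M \<Longrightarrow> n \<ge> M \<Longrightarrow>
        norm (blinfun_apply P (x (r m)) - blinfun_apply P (x (r n))) < d"
      using CauchyD[OF convergent_Cauchy[OF r(2)]] by blast
    have "dist (blinfun_apply R (x (r m))) (blinfun_apply R (x (r n))) < e"
      if "m \<ge> M" "n \<ge> M" for m n
    proof -
      let ?y = "x (r m) - x (r n)"
      have y: "norm ?y \<le> 2 * B"
        using norm_triangle_ineq4[of "x (r m)" "x (r n)"] B(2)[of "r m"] B(2)[of "r n"] by linarith
      have Py: "norm (blinfun_apply P ?y) < d" using M[OF that] by (simp add: blinfun.diff_right)
      have "(norm (blinfun_apply R ?y))\<^sup>2 \<le> c * norm (blinfun_apply P ?y) * norm ?y" by (rule dom)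
      also have "\<dots> \<le> \<bar>c\<bar> * norm (blinfun_apply P ?y) * norm ?y"
        by (intro mult_right_mono) auto
      also have "\<dots> \<le> \<bar>c\<bar> * d * (2 * B)"
        using y Py \<open>d > 0\<close> by (intro mult_mono) auto
      also have "\<dots> < (\<bar>c\<bar> + 1) * d * (2 * B)" using \<open>d > 0\<close> B by simp
      also have "\<dots> = e\<^sup>2" using B by (simp add: d_def)
      finally have "norm (blinfun_apply R ?y) < e" using e by (simp add: power_less_imp_less_base)
      then show ?thesis by (simp add: dist_norm blinfun.diff_right)
    qed
    then show "\<exists>M. \<forall>m\<ge>M. \<forall>n\<ge>M. dist (blinfun_apply R (x (r m))) (blinfun_apply R (x (r n))) < e"
      by blast
  qed
  then show "\<exists>r. strict_mono r \<and> convergent (\<lambda>n. blinfun_apply R (x (r n)))"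
    using r(1) Cauchy_convergent_iff by blast
qed

text \<open>A finite net for the image of a bounded set under \<open>K\<close> serves, with a larger
  radius, for its image under \<open>C\<close>; so compactness passes to operator norm
  limits.\<close>

lemma compact_op_if_approximable:
  fixes C :: "'a::complex_hilbert \<Rightarrow>\<^sub>L 'a"
  assumes C: "C \<in> bounded_ops"
    and approx: "\<And>e. e > 0 \<Longrightarrow>
      \<exists>K\<in>compact_ops. \<forall>x. norm (blinfun_apply C x - blinfun_apply K x) \<le> e * norm x"
  shows "C \<in> compact_ops"
proof -
  have "compact (closure (blinfun_apply C ` B))" if B: "bounded B" for B
    unfolding compact_eq_totally_bounded
  proof (intro conjI allI impI)
    show "complete (closure (blinfun_apply C ` B))" by (simp add: complete_eq_closed)
    fix e :: real assume e: "e > 0"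
    obtain b where b: "b > 0" "\<And>x. x \<in> B \<Longrightarrow> norm x \<le> b" using B bounded_pos by blast
    have "e / (4 * b) > 0" using e b by simp
    then obtain K where K: "K \<in> compact_ops"
      "\<And>x. norm (blinfun_apply C x - blinfun_apply K x) \<le> e / (4 * b) * norm x"
      using approx[of "e / (4 * b)"] by blast
    have "compact (closure (blinfun_apply K ` B))" using K(1) B by (simp add: compact_ops_def)
    moreover have "e / 4 > 0" using e by simp
    ultimately obtain k where
      k: "finite k" "closure (blinfun_apply K ` B) \<subseteq> (\<Union>x\<in>k. ball x (e/4))"
      unfolding compact_eq_totally_bounded by blast
    have "blinfun_apply C ` B \<subseteq> (\<Union>x\<in>k. cball x (e/2))"
    proof clarify
      fix x assume x: "x \<in> B"
      then have "blinfun_apply K x \<in> closure (blinfun_apply K ` B)"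
        by (intro subsetD[OF closure_subset] imageI)
      then obtain g where g: "g \<in> k" "dist g (blinfun_apply K x) < e/4"
        using subsetD[OF k(2)] by (metis UN_E mem_ball)
      have "norm (blinfun_apply C x - blinfun_apply K x) \<le> e / (4 * b) * b"
        using order_trans[OF K(2)[of x] mult_left_mono[OF b(2)[OF x] less_imp_le[OF \<open>e / (4 * b) > 0\<close>]]] .
      then have "dist (blinfun_apply K x) (blinfun_apply C x) \<le> e / 4"
        using b(1) by (simp add: dist_norm norm_minus_commute)
      then have "dist g (blinfun_apply C x) \<le> e/2"
        using g(2) dist_triangle[of g "blinfun_apply C x" "blinfun_apply K x"] by linarith
      then show "blinfun_apply C x \<in> (\<Union>x\<in>k. cball x (e/2))" using g(1) by auto
    qed
    then have "closure (blinfun_apply C ` B) \<subseteq> (\<Union>x\<in>k. cball x (e/2))"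
      using k(1) by (intro closure_minimal closed_UN) auto
    also have "\<dots> \<subseteq> (\<Union>x\<in>k. ball x e)" 
    proof clarify
      fix x g assume "g \<in> k" "x \<in> cball g (e/2)"
      then show "x \<in> (\<Union>x\<in>k. ball x e)" using e by (intro UN_I[of g]) auto
    qed
    finally show "\<exists>k. finite k \<and> closure (blinfun_apply C ` B) \<subseteq> (\<Union>x\<in>k. ball x e)"
      using k(1) by blast
  qed
  then show ?thesis using C by (simp add: compact_ops_def)
qed

section \<open>Finite-rank projections, and compactness as smallness on finite-codimensional
  subspaces\<close>

lemma bounded_opsI:
  assumes "\<And>x. blinfun_apply P x = f x" "\<And>c x. f (c *\<^sub>C x) = c *\<^sub>C f x"
  shows "P \<in> bounded_ops"
  using assms by (simp add: bounded_ops_def)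

lemma rank_one_compact:
  fixes f g :: "'a::complex_hilbert"
  obtains R where "R \<in> compact_ops" "\<And>x. blinfun_apply R x = cinner x f *\<^sub>C g"
proof -
  have bl: "bounded_linear (\<lambda>c. c *\<^sub>C g)"
  proof (rule bounded_linear_intro[of _ "norm g"])
    show "(r *\<^sub>R c) *\<^sub>C g = r *\<^sub>R (c *\<^sub>C g)" for r c
      by (simp add: scaleC_of_real[symmetric] scaleC_scaleC scaleR_conv_of_real)
  qed (auto simp: scaleC_add_left norm_scaleC)
  define R where "R = Blinfun (\<lambda>x. cinner x f *\<^sub>C g)"
  have R: "blinfun_apply R x = cinner x f *\<^sub>C g" for x
    unfolding R_def
    by (subst bounded_linear_Blinfun_apply)
      (auto intro: bounded_linear_compose[OF bl cinner.bounded_linear_left])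
  have "R \<in> compact_ops"
    unfolding compact_ops_iff_sequences
  proof (intro conjI allI impI)
    show "R \<in> bounded_ops"
      by (rule bounded_opsI[OF R]) (simp add: cinner_scaleC_left scaleC_scaleC)
    fix x :: "nat \<Rightarrow> 'a" assume "Bseq x"
    then have "Bseq (\<lambda>n. cinner (x n) f)"
      by (rule Bseq_bounded_linear[OF cinner.bounded_linear_left])
    then have "bounded (range (\<lambda>n. cinner (x n) f))" by (simp add: Bseq_eq_bounded)
    then obtain l r where r: "strict_mono r" "((\<lambda>n. cinner (x n) f) \<circ> r) \<longlonglongrightarrow> l"
      using bounded_imp_convergent_subsequence by blast
    then have "(\<lambda>n. cinner (x (r n)) f *\<^sub>C g) \<longlonglongrightarrow> l *\<^sub>C g"
      using bounded_linear.tendsto[OF bl] by (simp add: o_def)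
    then show "\<exists>r. strict_mono r \<and> convergent (\<lambda>n. blinfun_apply R (x (r n)))"
      using r(1) unfolding R convergent_def by blast
  qed
  then show ?thesis using R that by blast
qed

lemma cinner_span_zero:
  assumes "x \<in> perp F" "y \<in> complex_vector.span F"
  shows "cinner x y = 0"
proof -
  have "complex_vector.span F \<subseteq> {y. cinner x y = 0}"
  proof (rule complex_vector.span_minimal)
    show "F \<subseteq> {y. cinner x y = 0}" using assms(1) by (auto simp: perp_def)
    show "complex_vector.subspace {y. cinner x y = 0}"
      by (auto simp: complex_vector.subspace_def cinner_add_right cinner_scaleC_right)
  qed
  then show ?thesis using assms(2) by blast
qed

text \<open>Gram-Schmidt by induction: a new vector \<open>f\<close> contributes the rank-one
  projection onto its component orthogonal to the previous span. As a sum of rank-one operators,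
  \<open>P\<close> is compact.\<close>

lemma finite_span_projection:
  fixes F :: "'a::complex_hilbert set"
  assumes "finite F"
  shows "\<exists>P\<in>compact_ops. \<forall>x. blinfun_apply P x \<in> complex_vector.span F \<and>
    x - blinfun_apply P x \<in> perp F"
  using assms
proof induction
  case empty
  show ?case
    by (rule bexI[OF _ zero_compact_op]) (auto simp: perp_def complex_vector.span_zero)
next
  case (insert f F)
  then obtain P where P: "P \<in> compact_ops" "\<And>x. blinfun_apply P x \<in> complex_vector.span F"
    "\<And>x. x - blinfun_apply P x \<in> perp F" by blast
  define g where "g = f - blinfun_apply P f"
  have span_mono: "complex_vector.span F \<subseteq> complex_vector.span (insert f F)"
    by (rule complex_vector.span_mono) auto
  have gspan: "g \<in> complex_vector.span (insert f F)"
    unfolding g_def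
    by (intro complex_vector.span_diff complex_vector.span_base subsetD[OF span_mono P(2)]) simp
  have gperp: "g \<in> perp F" unfolding g_def by (rule P)
  \<comment> \<open>The projection onto the line of \<open>g\<close>. If \<open>f\<close> already
    lies in the span, then \<open>g = 0\<close> and \<open>R\<close> vanishes, so one formula covers
    both cases.\<close>
  obtain R where R: "R \<in> compact_ops"
    "\<And>x. blinfun_apply R x = cinner x g *\<^sub>C (complex_of_real (inverse ((norm g)\<^sup>2)) *\<^sub>C g)"
    using rank_one_compact by blast
  show ?case
  proof (rule bexI[of _ "P + R"], intro allI conjI)
    show "P + R \<in> compact_ops" by (rule compact_ops_add[OF P(1) R(1)])
    fix x
    show "blinfun_apply (P + R) x \<in> complex_vector.span (insert f F)"
      unfolding blinfun.add_left R
      using P(2) span_mono gspan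
      by (intro complex_vector.span_add complex_vector.span_scale) auto
    have y: "x - blinfun_apply P x \<in> perp F" by (rule P)
    define z where "z = x - blinfun_apply (P + R) x"
    have z: "z = (x - blinfun_apply P x)
        - (cinner x g * complex_of_real (inverse ((norm g)\<^sup>2))) *\<^sub>C g"
      by (simp add: z_def blinfun.add_left R scaleC_scaleC)
    have "z \<in> perp F" unfolding z
      by (rule complex_vector.subspace_diff[OF csubspace_perp y
            complex_vector.subspace_scale[OF csubspace_perp gperp]])
    moreover have "cinner z f = 0"
    proof -
      have "cinner z (blinfun_apply P f) = 0" using \<open>z \<in> perp F\<close> P(2) by (rule cinner_span_zero)
      moreover have "cinner (blinfun_apply P x) g = 0"
        using cinner_span_zero[OF gperp P(2)] by (rule cinner_eq_zero_commute[THEN iffD1])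
      then have "cinner z g = 0"
        by (cases "g = 0") (simp_all add: z cinner.diff_left cinner_scaleC_left cinner_self)
      ultimately show ?thesis using cinner.diff_right[of z f "blinfun_apply P f"] by (simp add: g_def)
    qed
    ultimately show "x - blinfun_apply (P + R) x \<in> perp (insert f F)"
      by (simp add: perp_def z_def)
  qed
qed

lemma norm_minus_projection_le:
  assumes "p \<in> complex_vector.span F" "x - p \<in> perp F"
  shows "norm (x - p) \<le> norm x"
proof -
  have "inner (x - p) p = 0"
    using cinner_span_zero[OF assms(2,1)] by (metis Re_cinner zero_complex.simps(1))
  then have "(norm x)\<^sup>2 = (norm (x - p))\<^sup>2 + (norm p)\<^sup>2"
    by (simp add: power2_norm_eq_inner algebra_simps inner_commute)
  then have "(norm (x - p))\<^sup>2 \<le> (norm x)\<^sup>2" by simp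
  then show ?thesis by (rule power2_le_imp_le) simp
qed

text \<open>Infinite dimension enters here: some vector lies outside the span of \<open>F\<close>,
  and its component in \<open>perp F\<close> can be normalised. All other uses of the assumption go
  through this fact.\<close>

lemma perp_finite_nonzero:
  fixes F :: "'a::complex_hilbert set"
  assumes "infinite_dimensional TYPE('a)" "finite F"
  obtains x where "x \<in> perp F" "norm x = 1"
proof -
  obtain P where P: "\<And>x. blinfun_apply P x \<in> complex_vector.span F"
    "\<And>x. x - blinfun_apply P x \<in> perp F" using finite_span_projection[OF assms(2)] by blast
  have "complex_vector.span F \<noteq> UNIV" using assms by (auto simp: infinite_dimensional_def)
  then obtain u where u: "u \<notin> complex_vector.span F" by blast
  define y where "y = u - blinfun_apply P u"
  have "y \<noteq> 0" using u P(1)[of u] by (auto simp: y_def)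
  have "inverse (norm y) *\<^sub>R y \<in> perp F"
    using P(2)[of u] subspace_scale[OF csubspace_imp_subspace[OF csubspace_perp]] by (simp add: y_def)
  moreover have "norm (inverse (norm y) *\<^sub>R y) = 1" using \<open>y \<noteq> 0\<close> by simp
  ultimately show ?thesis using that by blast
qed

text \<open>If \<open>P\<close> projects onto the span of \<open>F\<close>, then
  \<open>C - C o\<^sub>L P\<close> only sees the component in \<open>perp F\<close>, where
  \<open>C\<close> is small. Hence the compact operators \<open>C o\<^sub>L P\<close> approximate
  \<open>C\<close>.\<close>

lemma compact_op_if_small_on_perp:
  fixes C :: "'a::complex_hilbert \<Rightarrow>\<^sub>L 'a"
  assumes C: "C \<in> bounded_ops"
    and small: "\<And>e. e > 0 \<Longrightarrow> \<exists>F. finite F \<and> (\<forall>x\<in>perp F. norm (blinfun_apply C x) \<le> e * norm x)"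
  shows "C \<in> compact_ops"
proof (rule compact_op_if_approximable[OF C])
  fix e :: real assume e: "e > 0"
  obtain F where F: "finite F" "\<forall>x\<in>perp F. norm (blinfun_apply C x) \<le> e * norm x"
    using small[OF e] by (elim exE conjE)
  obtain P where P: "P \<in> compact_ops" "\<And>x. blinfun_apply P x \<in> complex_vector.span F"
    "\<And>x. x - blinfun_apply P x \<in> perp F" using finite_span_projection[OF F(1)] by blast
  show "\<exists>K\<in>compact_ops. \<forall>x. norm (blinfun_apply C x - blinfun_apply K x) \<le> e * norm x"
  proof (rule bexI[of _ "C o\<^sub>L P"], rule allI)
    show "C o\<^sub>L P \<in> compact_ops" by (rule compact_ops_compose_left[OF P(1) C])
    fix x
    have "norm (blinfun_apply C (x - blinfun_apply P x)) \<le> e * norm (x - blinfun_apply P x)"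
      by (rule F(2)[rule_format, OF P(3)])
    also have "\<dots> \<le> e * norm x"
      using norm_minus_projection_le[OF P(2,3)] e by (simp add: mult_left_mono)
    finally show "norm (blinfun_apply C x - blinfun_apply (C o\<^sub>L P) x) \<le> e * norm x"
      by (simp add: blinfun.diff_right)
  qed
qed

lemma self_adjoint_inner:
  "self_adjoint T \<Longrightarrow> inner (blinfun_apply T x) y = inner x (blinfun_apply T y)"
  unfolding self_adjoint_def is_adjoint_def by (metis Re_cinner)

text \<open>\<open>F\<close> is a finite net of radius \<open>e\<close> for the image of the unit
  ball. The norm of \<open>K x\<close> is the inner product of \<open>x\<close> with
  \<open>K y\<close> for a unit vector \<open>y\<close>, and subtracting a nearby net point from
  \<open>K y\<close> changes nothing when \<open>x\<close> is orthogonal to the net.\<close>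

lemma compact_self_adjoint_small_on_perp:
  fixes K :: "'a::complex_hilbert \<Rightarrow>\<^sub>L 'a"
  assumes K: "K \<in> compact_ops" "self_adjoint K" and e: "e > 0"
  shows "\<exists>F. finite F \<and> (\<forall>x\<in>perp F. norm (blinfun_apply K x) \<le> e * norm x)"
proof -
  have "compact (closure (blinfun_apply K ` cball 0 1))"
    using K(1) by (simp add: compact_ops_def)
  then obtain F where
    F: "finite F" "closure (blinfun_apply K ` cball 0 1) \<subseteq> (\<Union>x\<in>F. ball x e)"
    unfolding compact_eq_totally_bounded using e by blast
  have "norm (blinfun_apply K x) \<le> e * norm x" if x: "x \<in> perp F" for x
  proof (cases "blinfun_apply K x = 0")
    case False
    define y where "y = inverse (norm (blinfun_apply K x)) *\<^sub>R blinfun_apply K x"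
    have "y \<in> cball 0 1" using False by (simp add: y_def)
    then obtain g where g: "g \<in> F" "norm (blinfun_apply K y - g) < e"
    proof -
      have "blinfun_apply K y \<in> (\<Union>x\<in>F. ball x e)"
        using \<open>y \<in> cball 0 1\<close> by (intro subsetD[OF F(2)] subsetD[OF closure_subset] imageI)
      then show ?thesis using that by (auto simp: dist_norm norm_minus_commute)
    qed
    have "cinner x g = 0" using x g(1) by (simp add: perp_def)
    then have "inner x g = 0" using Re_cinner[of x g] by simp
    have "norm (blinfun_apply K x) = inner (blinfun_apply K x) y"
      using False by (simp add: y_def dot_square_norm power2_eq_square)
    also have "\<dots> = inner x (blinfun_apply K y - g)"
      using \<open>inner x g = 0\<close> by (simp add: self_adjoint_inner[OF K(2)] inner_diff_right)
    also have "\<dots> \<le> norm x * norm (blinfun_apply K y - g)" by (rule norm_cauchy_schwarz)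
    also have "\<dots> \<le> norm x * e" using g(2) by (intro mult_left_mono) auto
    finally show ?thesis by (simp add: mult.commute)
  qed (use e in simp)
  then show ?thesis using F(1) by blast
qed

section \<open>Maximisers of quadratic forms\<close>

text \<open>The degenerate case of Cauchy-Schwarz. It converts an inequality between two forms that
  is an equality at \<open>x\<close> into linear equations for \<open>x\<close>.\<close>

lemma semidefinite_form_zero:
  fixes b :: "'a::real_vector \<Rightarrow> 'a \<Rightarrow> real"
  assumes add: "\<And>x y z. b (x + y) z = b x z + b y z"
    and scale: "\<And>r x y. b (r *\<^sub>R x) y = r * b x y"
    and sym: "\<And>x y. b x y = b y x"
    and N: "subspace N" and nonneg: "\<And>x. x \<in> N \<Longrightarrow> 0 \<le> b x x"
    and xy: "x \<in> N" "y \<in> N" and zero: "b x x = 0"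
  shows "b x y = 0"
proof (rule ccontr)
  assume nz: "b x y \<noteq> 0"
  have add': "b z (x + y) = b z x + b z y" and scale': "b x (r *\<^sub>R y) = r * b x y" for x y z r
    using add[of x y z] scale[of r y x] by (simp_all add: sym)
  \<comment> \<open>Chosen so that \<open>2 * t * b x y + b y y\<close> equals -1, while the term
    quadratic in \<open>t\<close> vanishes.\<close>
  define t where "t = - (b y y + 1) / (2 * b x y)"
  have "t *\<^sub>R x + y \<in> N" using N xy by (simp add: subspace_add subspace_scale)
  then have "0 \<le> b (t *\<^sub>R x + y) (t *\<^sub>R x + y)" by (rule nonneg)
  also have "\<dots> = t * (t * b x x) + 2 * t * b x y + b y y"
    by (simp add: add scale add' scale' sym[of y x] algebra_simps)
  also have "\<dots> = -1" using zero nz by (simp add: t_def field_simps)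
  finally show False by simp
qed

lemma quadratic_form_le_SUP:
  fixes b :: "'a::real_normed_vector \<Rightarrow> 'a \<Rightarrow> real"
  assumes bb: "bounded_bilinear b" and N: "subspace N" and x: "x \<in> N"
  shows "b x x \<le> (SUP x\<in>{x \<in> N. norm x = 1}. b x x) * (norm x)\<^sup>2"
proof (cases "x = 0")
  case True
  then show ?thesis by (simp add: bounded_bilinear.zero_left[OF bb])
next
  case False
  obtain K where K: "\<And>x y. norm (b x y) \<le> norm x * norm y * K"
    using bounded_bilinear.bounded[OF bb] by blast
  have bdd: "bdd_above ((\<lambda>x. b x x) ` {x \<in> N. norm x = 1})"
  proof (rule bdd_aboveI2[of _ _ K])
    show "b x x \<le> K" if "x \<in> {x \<in> N. norm x = 1}" for x using K[of x x] that by auto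
  qed
  define u where "u = inverse (norm x) *\<^sub>R x"
  have u: "u \<in> {x \<in> N. norm x = 1}" using False N x by (simp add: u_def subspace_scale)
  have "x = norm x *\<^sub>R u" using False by (simp add: u_def)
  then have "b x x = (norm x)\<^sup>2 * b u u"
    by (metis bounded_bilinear.scaleR_left[OF bb] bounded_bilinear.scaleR_right[OF bb]
        mult.assoc power2_eq_square real_scaleR_def)
  then show ?thesis using mult_left_mono[OF cSUP_upper[OF u bdd], of "(norm x)\<^sup>2"] by (simp add: mult.commute)
qed

text \<open>
  A maximising sequence of unit vectors is Cauchy along a subsequence: the defect
  $c(x,y) = \mu\langle x,y\rangle - b(x,y)$ is a semidefinite form that tends to zero along it,
  hence also on differences, whereas there $b$ is asymptotically $\gamma\langle\cdot,\cdot\rangle$.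
\<close>

lemma quadratic_form_max_attained:
  fixes b :: "'a::{real_inner,complete_space} \<Rightarrow> 'a \<Rightarrow> real"
  assumes bb: "bounded_bilinear b" and sym: "\<And>x y. b x y = b y x"
    and N: "subspace N" "closed N" and u: "u \<in> N" "norm u = 1"
    and mu: "\<mu> = (SUP x\<in>{x \<in> N. norm x = 1}. b x x)" "\<mu> \<noteq> \<gamma>"
    and sub: "\<And>x :: nat \<Rightarrow> 'a. (\<forall>n. x n \<in> N \<and> norm (x n) = 1) \<Longrightarrow>
      \<exists>r::nat \<Rightarrow> nat. strict_mono r \<and> (\<forall>e>0. \<exists>M. \<forall>m\<ge>M. \<forall>n\<ge>M.
        \<bar>b (x (r m) - x (r n)) (x (r m) - x (r n)) - \<gamma> * (norm (x (r m) - x (r n)))\<^sup>2\<bar> < e)"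
  shows "\<exists>x\<in>N. norm x = 1 \<and> b x x = \<mu>"
proof -
  interpret b: bounded_bilinear b by (rule bb)
  have le: "b x x \<le> \<mu> * (norm x)\<^sup>2" if "x \<in> N" for x
    using quadratic_form_le_SUP[OF bb N(1) that] mu by simp
  have ne: "(\<lambda>x. b x x) ` {x \<in> N. norm x = 1} \<noteq> {}" using u by auto
  have "\<exists>x. x \<in> N \<and> norm x = 1 \<and> \<mu> - inverse (real (Suc n)) < b x x" for n
    using less_cSupD[OF ne, of "\<mu> - inverse (real (Suc n))"] mu(1) by auto
  then obtain x where x: "\<And>n. x n \<in> N" "\<And>n. norm (x n) = 1"
    and bx: "\<And>n. \<mu> - inverse (real (Suc n)) < b (x n) (x n)" by metis
  then obtain r :: "nat \<Rightarrow> nat" where r: "strict_mono r" "\<And>e. e > 0 \<Longrightarrow> \<exists>M. \<forall>m\<ge>M. \<forall>n\<ge>M.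
      \<bar>b (x (r m) - x (r n)) (x (r m) - x (r n)) - \<gamma> * (norm (x (r m) - x (r n)))\<^sup>2\<bar> < e"
    using sub[of x] by blast
  define y where "y n = x (r n)" for n
  have y: "y n \<in> N" "norm (y n) = 1" for n using x by (simp_all add: y_def)
  have byu: "b (y n) (y n) \<le> \<mu>" for n using le[OF y(1), of n] y(2) by simp
  have byl: "\<mu> - inverse (real (Suc n)) < b (y n) (y n)" for n
  proof -
    have "inverse (real (Suc (r n))) \<le> inverse (real (Suc n))"
      using seq_suble[OF r(1), of n] by (simp add: field_simps)
    then show ?thesis using bx[of "r n"] unfolding y_def by linarith
  qed
  \<comment> \<open>By the parallelogram law the defects at the sum and at the difference add up to
    twice those at \<open>y m\<close> and \<open>y n\<close>. Dropping the nonnegative defect at the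
    sum leaves the bound.\<close>
  have defect: "0 \<le> \<mu> * (norm (y m - y n))\<^sup>2 - b (y m - y n) (y m - y n) \<and>
      \<mu> * (norm (y m - y n))\<^sup>2 - b (y m - y n) (y m - y n)
        \<le> 2 * inverse (real (Suc m)) + 2 * inverse (real (Suc n))" for m n
  proof -
    have "0 \<le> \<mu> * (norm (y m + y n))\<^sup>2 - b (y m + y n) (y m + y n)"
      "0 \<le> \<mu> * (norm (y m - y n))\<^sup>2 - b (y m - y n) (y m - y n)"
      using y N(1) le by (simp_all add: subspace_add subspace_diff)
    moreover have "(norm (y m + y n))\<^sup>2 + (norm (y m - y n))\<^sup>2 = 4"
      using y(2)[of m] y(2)[of n]
      by (simp add: power2_norm_eq_inner algebra_simps inner_commute norm_eq_1)
    then have "\<mu> * (norm (y m + y n))\<^sup>2 + \<mu> * (norm (y m - y n))\<^sup>2 = 4 * \<mu>"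
      by (metis distrib_left mult.commute)
    moreover have "b (y m + y n) (y m + y n) + b (y m - y n) (y m - y n)
        = 2 * b (y m) (y m) + 2 * b (y n) (y n)"
      by (simp add: b.add_left b.add_right b.diff_left b.diff_right)
    ultimately show ?thesis using byl[of m] byl[of n] by linarith
  qed
  have "Cauchy y"
  proof (rule metric_CauchyI)
    fix e :: real assume e: "e > 0"
    \<comment> \<open>Of the five parts, the defect uses less than \<open>4 * d\<close>, and
      comparing \<open>b\<close> with \<open>\<gamma>\<close> times the squared norm uses less than
      \<open>d\<close>.\<close>
    define d where "d = \<bar>\<mu> - \<gamma>\<bar> * e\<^sup>2 / 5"
    have d: "d > 0" using e mu(2) by (simp add: d_def)
    obtain M1 where M1: "inverse (real (Suc M1)) < d" using reals_Archimedean[OF d] by blast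
    obtain M2 where M2: "\<And>m n. m \<ge> M2 \<Longrightarrow> n \<ge> M2 \<Longrightarrow>
       \<bar>b (y m - y n) (y m - y n) - \<gamma> * (norm (y m - y n))\<^sup>2\<bar> < d"
      using r(2)[OF d] unfolding y_def by blast
    have "dist (y m) (y n) < e" if "m \<ge> max M1 M2" "n \<ge> max M1 M2" for m n
    proof -
      have "inverse (real (Suc m)) \<le> inverse (real (Suc M1))"
        "inverse (real (Suc n)) \<le> inverse (real (Suc M1))" using that by (auto simp: field_simps)
      then have "\<bar>\<mu> * (norm (y m - y n))\<^sup>2 - b (y m - y n) (y m - y n)\<bar> < 4 * d"
        using defect[of m n] M1 by linarith
      then have "\<bar>\<mu> * (norm (y m - y n))\<^sup>2 - \<gamma> * (norm (y m - y n))\<^sup>2\<bar> < 5 * d"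
        using M2[of m n] that by linarith
      then have "\<bar>\<mu> - \<gamma>\<bar> * (norm (y m - y n))\<^sup>2 < \<bar>\<mu> - \<gamma>\<bar> * e\<^sup>2"
        by (simp add: d_def left_diff_distrib[symmetric] abs_mult)
      then have "(norm (y m - y n))\<^sup>2 < e\<^sup>2" by (simp add: mult_less_cancel_left)
      then show ?thesis using e by (simp add: dist_norm power_less_imp_less_base)
    qed
    then show "\<exists>M. \<forall>m\<ge>M. \<forall>n\<ge>M. dist (y m) (y n) < e" by blast
  qed
  then obtain l where l: "y \<longlonglongrightarrow> l" using Cauchy_convergent_iff convergent_def by blast
  have "l \<in> N" using closed_sequentially[OF N(2)] y(1) l by blast
  moreover have "norm l = 1"
    using LIMSEQ_unique[OF tendsto_norm[OF l]] y(2) by simp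
  moreover have "(\<lambda>n. b (y n) (y n)) \<longlonglongrightarrow> \<mu>"
  proof (rule tendsto_sandwich[OF _ _ _ tendsto_const])
    show "(\<lambda>n. \<mu> - inverse (real (Suc n))) \<longlonglongrightarrow> \<mu>"
      using tendsto_diff[OF tendsto_const LIMSEQ_inverse_real_of_nat] by fastforce
  qed (use byl byu in \<open>auto intro!: always_eventually less_imp_le simp del: of_nat_Suc\<close>)
  then have "b l l = \<mu>" using LIMSEQ_unique[OF b.tendsto[OF l l]] by blast
  ultimately show ?thesis by blast
qed

text \<open>The first-order condition at a maximiser: \<open>\<mu> * inner x y - b x y\<close> is
  semidefinite on \<open>N\<close> and vanishes at the maximiser, which therefore lies in its
  radical.\<close>

lemma quadratic_form_maximizer_eq:
  fixes b :: "'a::real_inner \<Rightarrow> 'a \<Rightarrow> real"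
  assumes bb: "bounded_bilinear b" and sym: "\<And>x y. b x y = b y x"
    and N: "subspace N" and le: "\<And>x. x \<in> N \<Longrightarrow> b x x \<le> \<mu> * (norm x)\<^sup>2"
    and x: "x \<in> N" "norm x = 1" "b x x = \<mu>" and y: "y \<in> N"
  shows "b x y = \<mu> * inner x y"
proof -
  have "\<mu> * inner x y - b x y = 0"
  proof (rule semidefinite_form_zero[where b = "\<lambda>x y. \<mu> * inner x y - b x y", OF _ _ _ N _ x(1) y])
    show "0 \<le> \<mu> * inner x x - b x x" if "x \<in> N" for x
      using le[OF that] by (simp add: power2_norm_eq_inner)
    show "\<mu> * inner x x - b x x = 0" using x by (simp add: norm_eq_1)
    show "\<mu> * inner x y - b x y = \<mu> * inner y x - b y x" for x y
      using sym[of x y] by (simp add: inner_commute)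
  qed (simp_all add: bounded_bilinear.add_left[OF bb] bounded_bilinear.scaleR_left[OF bb]
      inner_add_left algebra_simps)
  then show ?thesis by simp
qed

section \<open>Forms that a compact operator controls up to a multiple of the squared norm\<close>

lemma bounded_bilinear_inner_blinfun:
  "bounded_bilinear (\<lambda>x y. inner (blinfun_apply S x) (blinfun_apply T y))"
  using bounded_bilinear.comp[OF bounded_bilinear_inner blinfun.bounded_linear_right
      blinfun.bounded_linear_right] .

lemma bounded_bilinear_inner_blinfun_left:
  "bounded_bilinear (\<lambda>x y. inner (blinfun_apply S x) y)"
  using bounded_bilinear_inner_blinfun[of S id_blinfun] by simp

lemma compact_op_subseq_small_differences:
  fixes x :: "nat \<Rightarrow> 'a::complex_hilbert"
  assumes K: "K \<in> compact_ops" and x: "\<forall>n. norm (x n) = 1"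
  obtains r :: "nat \<Rightarrow> nat" where "strict_mono r"
    "\<And>e. e > 0 \<Longrightarrow> \<exists>M. \<forall>m\<ge>M. \<forall>n\<ge>M. norm (blinfun_apply K (x (r m) - x (r n))) < e"
proof -
  have "Bseq x" using x by (intro BseqI'[of _ 1]) simp
  then obtain r where r: "strict_mono r" "convergent (\<lambda>n. blinfun_apply K (x (r n)))"
    using compact_opsD[OF K] by blast
  show ?thesis
    by (rule that[OF r(1)]) (use CauchyD[OF convergent_Cauchy[OF r(2)]] in \<open>simp add: blinfun.diff_right\<close>)
qed

text \<open>Along a suitable subsequence differences have small images under \<open>K\<close>, so on
  them \<open>b\<close> is asymptotically \<open>\<gamma>\<close> times the squared norm. The norm
  bound 2 is the size of a difference of unit vectors; it lets quadratic errors be estimated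
  linearly in \<open>K d\<close>.\<close>

lemma quadratic_form_max_attained_compact:
  fixes b :: "'a::complex_hilbert \<Rightarrow> 'a \<Rightarrow> real"
  assumes bb: "bounded_bilinear b" and sym: "\<And>x y. b x y = b y x"
    and N: "subspace N" "closed N" and u: "u \<in> N" "norm u = 1"
    and mu: "\<mu> = (SUP x\<in>{x \<in> N. norm x = 1}. b x x)" "\<mu> \<noteq> \<gamma>"
    and K: "K \<in> compact_ops"
    and bound: "\<And>d. d \<in> N \<Longrightarrow> norm d \<le> 2 \<Longrightarrow>
      \<bar>b d d - \<gamma> * (norm d)\<^sup>2\<bar> \<le> C * norm (blinfun_apply K d)"
  shows "\<exists>x\<in>N. norm x = 1 \<and> b x x = \<mu>"
proof (rule quadratic_form_max_attained[OF bb sym N u mu])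
  fix x :: "nat \<Rightarrow> 'a" assume x: "\<forall>n. x n \<in> N \<and> norm (x n) = 1"
  then obtain r :: "nat \<Rightarrow> nat" where r: "strict_mono r"
    "\<And>e. e > 0 \<Longrightarrow> \<exists>M. \<forall>m\<ge>M. \<forall>n\<ge>M. norm (blinfun_apply K (x (r m) - x (r n))) < e"
    using compact_op_subseq_small_differences[OF K] by metis
  show "\<exists>r::nat \<Rightarrow> nat. strict_mono r \<and> (\<forall>e>0. \<exists>M. \<forall>m\<ge>M. \<forall>n\<ge>M.
     \<bar>b (x (r m) - x (r n)) (x (r m) - x (r n)) - \<gamma> * (norm (x (r m) - x (r n)))\<^sup>2\<bar> < e)"
  proof (intro exI[of _ r] conjI r(1) allI impI)
    fix e :: real assume e: "e > 0"
    then have "e / (\<bar>C\<bar> + 1) > 0" by simp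
    from r(2)[OF this] obtain M where
      M: "\<forall>m\<ge>M. \<forall>n\<ge>M. norm (blinfun_apply K (x (r m) - x (r n))) < e / (\<bar>C\<bar> + 1)" by blast
    show "\<exists>M. \<forall>m\<ge>M. \<forall>n\<ge>M.
     \<bar>b (x (r m) - x (r n)) (x (r m) - x (r n)) - \<gamma> * (norm (x (r m) - x (r n)))\<^sup>2\<bar> < e"
    proof (intro exI[of _ M] allI impI)
      fix m n assume mn: "m \<ge> M" "n \<ge> M"
      let ?d = "x (r m) - x (r n)"
      have d: "?d \<in> N" "norm ?d \<le> 2"
        using x norm_triangle_ineq4[of "x (r m)" "x (r n)"] N(1) by (simp_all add: subspace_diff)
      have "\<bar>b ?d ?d - \<gamma> * (norm ?d)\<^sup>2\<bar> \<le> C * norm (blinfun_apply K ?d)" using bound[OF d] .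
      also have "\<dots> \<le> (\<bar>C\<bar> + 1) * norm (blinfun_apply K ?d)" by (intro mult_right_mono) auto
      also have "\<dots> < (\<bar>C\<bar> + 1) * (e / (\<bar>C\<bar> + 1))"
        using M mn by (intro mult_strict_left_mono) auto
      finally show "\<bar>b ?d ?d - \<gamma> * (norm ?d)\<^sup>2\<bar> < e" by simp
    qed
  qed
qed

text \<open>The form of \<open>K\<close> is controlled by \<open>K\<close> itself, so
  \<open>\<gamma> = 0\<close> applies and a positive supremum is attained. Invariance of
  \<open>N\<close> puts \<open>K x - \<mu> x\<close> into \<open>N\<close>; the first-order
  condition, tested against this vector, makes it orthogonal to itself.\<close>

lemma positive_eigenvector_exists:
  assumes K: "K \<in> compact_ops" "self_adjoint K" and N: "subspace N" "closed N"
    and inv: "\<And>x. x \<in> N \<Longrightarrow> blinfun_apply K x \<in> N"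
    and z: "z \<in> N" "inner (blinfun_apply K z) z > 0"
  obtains \<mu> x where "\<mu> > 0" "x \<in> N" "norm x = 1" "blinfun_apply K x = \<mu> *\<^sub>R x"
proof -
  define \<mu> where "\<mu> = (SUP x\<in>{x \<in> N. norm x = 1}. inner (blinfun_apply K x) x)"
  note bb = bounded_bilinear_inner_blinfun_left[of K]
  have le: "inner (blinfun_apply K x) x \<le> \<mu> * (norm x)\<^sup>2" if "x \<in> N" for x
    unfolding \<mu>_def by (rule quadratic_form_le_SUP[OF bb N(1) that])
  have sym: "inner (blinfun_apply K x) y = inner (blinfun_apply K y) x" for x y
    by (metis self_adjoint_inner[OF K(2)] inner_commute)
  have \<mu>: "\<mu> > 0" using le[OF z(1)] z(2) by (smt (verit) mult_nonpos_nonneg zero_le_power2)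
  have "z \<noteq> 0" using z by auto
  then have u: "inverse (norm z) *\<^sub>R z \<in> N" "norm (inverse (norm z) *\<^sub>R z) = 1"
    using z N by (auto simp: subspace_scale)
  have "\<exists>x\<in>N. norm x = 1 \<and> inner (blinfun_apply K x) x = \<mu>"
  proof (rule quadratic_form_max_attained_compact[OF bb sym N u \<mu>_def _ K(1), of 0 2])
    show "\<mu> \<noteq> 0" using \<mu> by simp
    fix d assume "d \<in> N" "norm d \<le> 2"
    then have "norm (blinfun_apply K d) * norm d \<le> norm (blinfun_apply K d) * 2"
      by (intro mult_left_mono) auto
    then show "\<bar>inner (blinfun_apply K d) d - 0 * (norm d)\<^sup>2\<bar> \<le> 2 * norm (blinfun_apply K d)"
      using Cauchy_Schwarz_ineq2[of "blinfun_apply K d" d] by simp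
  qed
  then obtain x where x: "x \<in> N" "norm x = 1" "inner (blinfun_apply K x) x = \<mu>" by blast
  define v where "v = blinfun_apply K x - \<mu> *\<^sub>R x"
  have v: "v \<in> N" unfolding v_def using x N(1) inv by (simp add: subspace_diff subspace_scale)
  have "inner (blinfun_apply K x) v = \<mu> * inner x v"
    using quadratic_form_maximizer_eq[OF bb sym N(1) le x v] .
  then have "inner v v = 0" by (subst v_def) (simp add: inner_diff_left)
  then show ?thesis using that[OF \<mu> x(1,2)] by (simp add: v_def)
qed

section \<open>Absolutely norm attaining operators\<close>

lemma norm_attaining_onD:
  assumes "norm_attaining_on T M"
  obtains x where "x \<in> M" "norm x = 1"
    "\<And>y. y \<in> M \<Longrightarrow> norm y = 1 \<Longrightarrow> norm (blinfun_apply T y) \<le> norm (blinfun_apply T x)"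
proof -
  obtain x where x: "x \<in> M" "norm x = 1"
    "norm (blinfun_apply T x) = (SUP y\<in>{y \<in> M. norm y = 1}. norm (blinfun_apply T y))"
    using assms unfolding norm_attaining_on_def by blast
  have bdd: "bdd_above ((\<lambda>y. norm (blinfun_apply T y)) ` {y \<in> M. norm y = 1})"
  proof (rule bdd_aboveI2[of _ _ "norm T"])
    show "norm (blinfun_apply T y) \<le> norm T" if "y \<in> {y \<in> M. norm y = 1}" for y
      using norm_blinfun[of T y] that by simp
  qed
  show ?thesis
  proof (rule that[OF x(1,2)])
    fix y assume "y \<in> M" "norm y = 1"
    then show "norm (blinfun_apply T y) \<le> norm (blinfun_apply T x)"
      unfolding x(3) by (intro cSUP_upper bdd) simp
  qed
qed

lemma norm_attaining_onI:
  assumes "x \<in> M" "norm x = 1"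
    "\<And>y. y \<in> M \<Longrightarrow> norm y = 1 \<Longrightarrow> norm (blinfun_apply T y) \<le> norm (blinfun_apply T x)"
  shows "norm_attaining_on T M"
proof -
  have "(SUP y\<in>{y \<in> M. norm y = 1}. norm (blinfun_apply T y)) = norm (blinfun_apply T x)"
    by (rule cSup_eq_maximum) (use assms in auto)
  then show ?thesis unfolding norm_attaining_on_def using assms(1,2) by auto
qed

text \<open>The square of the essential norm: for complex linear \<open>T\<close> on an
  infinite-dimensional space, its root is the distance from \<open>T\<close> to the compact
  operators. Collecting the admissible bounds \<open>a\<close> avoids a supremum nested in the
  infimum.\<close>

definition essential_sq_norm :: "('a::complex_hilbert \<Rightarrow>\<^sub>L 'a) \<Rightarrow> real" where
  "essential_sq_norm T =
     Inf {a. \<exists>F. finite F \<and> (\<forall>x\<in>perp F. (norm (blinfun_apply T x))\<^sup>2 \<le> a * (norm x)\<^sup>2)}"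

lemma
  fixes T :: "'a::complex_hilbert \<Rightarrow>\<^sub>L 'a"
  assumes inf: "infinite_dimensional TYPE('a)"
  shows essential_sq_norm_nonneg: "0 \<le> essential_sq_norm T"
    and essential_sq_norm_le: "\<And>F a. finite F \<Longrightarrow>
      (\<And>x. x \<in> perp F \<Longrightarrow> (norm (blinfun_apply T x))\<^sup>2 \<le> a * (norm x)\<^sup>2) \<Longrightarrow>
      essential_sq_norm T \<le> a"
    and essential_sq_norm_upper: "\<And>e. e > 0 \<Longrightarrow> \<exists>F. finite F \<and>
      (\<forall>x\<in>perp F. (norm (blinfun_apply T x))\<^sup>2 \<le> (essential_sq_norm T + e) * (norm x)\<^sup>2)"
proof -
  define A where
    "A = {a. \<exists>F. finite F \<and> (\<forall>x\<in>perp F. (norm (blinfun_apply T x))\<^sup>2 \<le> a * (norm x)\<^sup>2)}"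
  have A_nonneg: "0 \<le> a" if "a \<in> A" for a
  proof -
    obtain F where F: "finite F" "\<forall>x\<in>perp F. (norm (blinfun_apply T x))\<^sup>2 \<le> a * (norm x)\<^sup>2"
      using \<open>a \<in> A\<close> unfolding A_def by blast
    obtain x where "x \<in> perp F" "norm x = 1" using perp_finite_nonzero[OF inf F(1)] .
    then have "(norm (blinfun_apply T x))\<^sup>2 \<le> a" using F(2) by fastforce
    then show ?thesis by (rule order_trans[OF zero_le_power2])
  qed
  have "(norm (blinfun_apply T x))\<^sup>2 \<le> (norm T)\<^sup>2 * (norm x)\<^sup>2" for x
    using power_mono[OF norm_blinfun[of T x], of 2] by (simp add: power_mult_distrib)
  then have "(norm T)\<^sup>2 \<in> A" unfolding A_def by (auto intro!: exI[of _ "{}"])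
  then have ne: "A \<noteq> {}" by blast
  have bdd: "bdd_below A" using A_nonneg by (rule bdd_belowI)
  have eq: "essential_sq_norm T = Inf A" by (simp add: essential_sq_norm_def A_def)
  show "0 \<le> essential_sq_norm T" unfolding eq using ne A_nonneg by (rule cInf_greatest)
  show "essential_sq_norm T \<le> a" if "finite F"
    "\<And>x. x \<in> perp F \<Longrightarrow> (norm (blinfun_apply T x))\<^sup>2 \<le> a * (norm x)\<^sup>2" for F a
    unfolding eq by (rule cInf_lower[OF _ bdd]) (use that in \<open>auto simp: A_def\<close>)
  show "\<exists>F. finite F \<and>
      (\<forall>x\<in>perp F. (norm (blinfun_apply T x))\<^sup>2 \<le> (essential_sq_norm T + e) * (norm x)\<^sup>2)"
    if e: "e > 0" for e
  proof -
    obtain a where a: "a \<in> A" "a < essential_sq_norm T + e"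
      using cInf_lessD[OF ne, of "essential_sq_norm T + e"] e eq by auto
    then obtain F where F: "finite F"
      "\<forall>x\<in>perp F. (norm (blinfun_apply T x))\<^sup>2 \<le> a * (norm x)\<^sup>2" unfolding A_def by blast
    have "(norm (blinfun_apply T x))\<^sup>2 \<le> (essential_sq_norm T + e) * (norm x)\<^sup>2"
      if "x \<in> perp F" for x
      using F(2) that mult_right_mono[OF less_imp_le[OF a(2)], of "(norm x)\<^sup>2"]
      by (meson order_trans zero_le_power2)
    then show ?thesis using F(1) by blast
  qed
qed

text \<open>The intermediate value theorem is applied along the segment from \<open>x\<close> to
  \<open>y\<close>. Hitting a prescribed value exactly is what later gives distinct, strictly
  increasing values on an orthogonal system.\<close>

lemma intermediate_sq_norm:
  fixes x y :: "'a::complex_hilbert"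
  assumes N: "subspace N" "x \<in> N" "y \<in> N"
    and x: "(norm (blinfun_apply S x))\<^sup>2 > v * (norm x)\<^sup>2"
    and y: "(norm (blinfun_apply S y))\<^sup>2 < v * (norm y)\<^sup>2"
  obtains z where "z \<in> N" "norm z = 1" "(norm (blinfun_apply S z))\<^sup>2 = v"
proof -
  define w where "w t = (1 - t) *\<^sub>R x + t *\<^sub>R y" for t :: real
  define g where "g t = (norm (blinfun_apply S (w t)))\<^sup>2 - v * (norm (w t))\<^sup>2" for t
  have "continuous_on {0..1} g" unfolding g_def w_def by (intro continuous_intros)
  moreover have "g 1 \<le> 0" "0 \<le> g 0" using x y by (simp_all add: g_def w_def)
  ultimately obtain t where t: "0 \<le> t" "t \<le> 1" "g t = 0"
    using IVT2'[of g 1 0 0] by auto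
  \<comment> \<open>If the segment met 0, then \<open>y\<close> would be a real multiple of
    \<open>x\<close>, and a quadratic form cannot take values of opposite strict sign at the
    two.\<close>
  have "w t \<noteq> 0"
  proof
    assume 0: "w t = 0"
    have "t \<noteq> 0" using 0 x by (auto simp: w_def)
    have "t *\<^sub>R y = (t - 1) *\<^sub>R x" using 0 by (simp add: w_def algebra_simps add_eq_0_iff2)
    then have "inverse t *\<^sub>R (t *\<^sub>R y) = inverse t *\<^sub>R ((t - 1) *\<^sub>R x)" by simp
    then have "y = ((t - 1) / t) *\<^sub>R x"
      using \<open>t \<noteq> 0\<close> by (simp add: divide_inverse mult.commute)
    then obtain c where yx: "y = c *\<^sub>R x" by blast
    have "c\<^sup>2 * (norm (blinfun_apply S x))\<^sup>2 < c\<^sup>2 * (v * (norm x)\<^sup>2)"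
      using y unfolding yx by (simp add: blinfun.scaleR_right power_mult_distrib mult.left_commute)
    then show False using x by (simp add: mult_less_cancel_left)
  qed
  define z where "z = inverse (norm (w t)) *\<^sub>R w t"
  have "w t \<in> N" unfolding w_def using N by (simp add: subspace_add subspace_scale)
  then have "z \<in> N" using N(1) by (simp add: z_def subspace_scale)
  moreover have "norm z = 1" using \<open>w t \<noteq> 0\<close> by (simp add: z_def)
  moreover have "(norm (blinfun_apply S z))\<^sup>2 = v"
    using t(3) \<open>w t \<noteq> 0\<close>
    by (simp add: z_def g_def blinfun.scaleR_right power_mult_distrib power_inverse field_simps)
  ultimately show ?thesis using that by blast
qed

text \<open>
  If the lower bound failed, one could choose orthonormal vectors $z_n$ with pairwise orthogonal
  images and $\|Sz_n\|^2$ strictly increasing to the essential value $\alpha$; on their closed span,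
  written here as a double orthogonal complement, $S$ does not attain its norm.
\<close>

lemma AN_ops_essential_lower:
  fixes S :: "'a::complex_hilbert \<Rightarrow>\<^sub>L 'a"
  assumes inf: "infinite_dimensional TYPE('a)" and S: "S \<in> AN_ops" and e: "e > 0"
  shows "\<exists>F. finite F \<and>
    (\<forall>x\<in>perp F. (essential_sq_norm S - e) * (norm x)\<^sup>2 \<le> (norm (blinfun_apply S x))\<^sup>2)"
proof (rule ccontr)
  assume contra: "\<not> ?thesis"
  define \<alpha> where "\<alpha> = essential_sq_norm S"
  \<comment> \<open>The values increase strictly from \<open>\<alpha> - e\<close> at
    \<open>n = 0\<close> and stay below \<open>\<alpha>\<close>. In every finite-codimensional
    \<open>perp F\<close>, the assumed failure gives a vector below \<open>v n\<close>, and the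
    definition of \<open>\<alpha>\<close> gives one above it.\<close>
  define v where "v n = \<alpha> - e * inverse (real (Suc n))" for n
  have v_less: "v n < \<alpha>" for n using e by (simp add: v_def)
  have "e * inverse (real (Suc n)) \<le> e * 1" for n
    using e by (intro mult_left_mono) (auto simp: inverse_eq_divide)
  then have v_ge: "\<alpha> - e \<le> v n" for n unfolding v_def by (simp del: of_nat_Suc)
  have SB: "S \<in> bounded_ops" using S by (simp add: AN_ops_def)
  have step: "\<exists>z. z \<in> perp F \<and> norm z = 1 \<and> (norm (blinfun_apply S z))\<^sup>2 = v n"
    if F: "finite F" for F n
  proof -
    obtain y where y: "y \<in> perp F" "(norm (blinfun_apply S y))\<^sup>2 < (\<alpha> - e) * (norm y)\<^sup>2"
      using contra F unfolding \<alpha>_def by (meson not_le)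
    have "(\<alpha> - e) * (norm y)\<^sup>2 \<le> v n * (norm y)\<^sup>2" by (rule mult_right_mono[OF v_ge]) simp
    then have y2: "(norm (blinfun_apply S y))\<^sup>2 < v n * (norm y)\<^sup>2" using y(2) by linarith
    obtain x where x: "x \<in> perp F" "v n * (norm x)\<^sup>2 < (norm (blinfun_apply S x))\<^sup>2"
      using essential_sq_norm_le[OF inf F, of S "v n"] v_less[of n] unfolding \<alpha>_def by (meson not_le)
    show ?thesis
      using intermediate_sq_norm[OF csubspace_imp_subspace[OF csubspace_perp] x(1) y(1) x(2) y2]
      by metis
  qed
  obtain ad where ad: "\<And>u x. cinner (blinfun_apply S x) u = cinner x (ad u)"
    using adjoint_vector_exists[OF SB] by metis
  define g where "g n F = (SOME z. z \<in> perp F \<and> norm z = 1 \<and> (norm (blinfun_apply S z))\<^sup>2 = v n)"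
    for n F
  have g: "g n F \<in> perp F \<and> norm (g n F) = 1 \<and> (norm (blinfun_apply S (g n F)))\<^sup>2 = v n"
    if "finite F" for F n
    unfolding g_def by (rule someI_ex[OF step[OF that]])
  \<comment> \<open>Besides the vector itself, the adjoint applied to its image joins the
    constraints: orthogonality to the former separates the vectors, orthogonality to the latter
    their images.\<close>
  define Fs where "Fs = rec_nat {} (\<lambda>n F. insert (g n F) (insert (ad (blinfun_apply S (g n F))) F))"
  have Fs: "Fs 0 = {}"
    "Fs (Suc n) = insert (g n (Fs n)) (insert (ad (blinfun_apply S (g n (Fs n)))) (Fs n))" for n
    by (simp_all add: Fs_def)
  have fin: "finite (Fs n)" for n by (induction n) (simp_all add: Fs)
  define z where "z n = g n (Fs n)" for n
  have z: "z n \<in> perp (Fs n)" "norm (z n) = 1" "(norm (blinfun_apply S (z n)))\<^sup>2 = v n" for n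
    using g[OF fin] by (simp_all add: z_def)
  have mono: "Fs m \<subseteq> Fs n" if "m \<le> n" for m n
    using that by (rule lift_Suc_mono_le[rotated]) (auto simp: Fs)
  have orth_less: "cinner (z n) (z m) = 0 \<and> cinner (blinfun_apply S (z n)) (blinfun_apply S (z m)) = 0"
    if "m < n" for m n
  proof -
    have "z m \<in> Fs n" "ad (blinfun_apply S (z m)) \<in> Fs n"
      using mono[of "Suc m" n] that by (auto simp: Fs z_def)
    then show ?thesis using z(1)[of n] by (simp add: perp_def ad)
  qed
  have orth: "cinner (z m) (z n) = 0" "cinner (blinfun_apply S (z m)) (blinfun_apply S (z n)) = 0"
    if "m \<noteq> n" for m n
    using orth_less[of m n] orth_less[of n m] that cinner_eq_zero_commute by (metis nat_neq_iff)+
  define M where "M = perp (perp (range z))"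
  have sM: "subspace M" unfolding M_def by (rule csubspace_imp_subspace[OF csubspace_perp])
  have zM: "z n \<in> M" for n
    unfolding M_def perp_def using cinner_eq_zero_commute by blast
  have diag: "cinner (blinfun_apply S x) (blinfun_apply S (z n)) = complex_of_real (v n) * cinner x (z n)"
    if x: "x \<in> M" for x n
  proof -
    \<comment> \<open>\<open>u\<close> is orthogonal to every \<open>z m\<close>: for
      \<open>m = n\<close> by the prescribed value \<open>v n\<close>, otherwise by orthogonality of
      the vectors and of their images. Hence it is orthogonal to the double complement
      \<open>M\<close>.\<close>
    define u where "u = ad (blinfun_apply S (z n)) - complex_of_real (v n) *\<^sub>C z n"
    have "cinner (z m) u = 0" for m
    proof (cases "m = n")
      case True
      then show ?thesis
        using z(2,3)[of n] by (simp add: u_def cinner.diff_right cinner_scaleC_right ad[symmetric] cinner_self)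
    next
      case False
      then show ?thesis
        using orth by (simp add: u_def cinner.diff_right cinner_scaleC_right ad[symmetric])
    qed
    then have "u \<in> perp (range z)" unfolding perp_def using cinner_eq_zero_commute by blast
    then have "cinner x u = 0" using x by (simp add: M_def perp_def)
    then show ?thesis by (simp add: u_def cinner.diff_right cinner_scaleC_right ad[symmetric])
  qed
  have "M \<noteq> {0}" using zM[of 0] z(2)[of 0] by auto
  then have "norm_attaining_on S M"
    using S unfolding AN_ops_def M_def by (simp add: csubspace_perp closed_perp)
  then obtain x where x: "x \<in> M" "norm x = 1"
    and max: "\<And>y. y \<in> M \<Longrightarrow> norm y = 1 \<Longrightarrow> norm (blinfun_apply S y) \<le> norm (blinfun_apply S x)"
    using norm_attaining_onD by metis
  \<comment> \<open>The attained maximum exceeds every \<open>v n\<close>, because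
    \<open>v (Suc n)\<close> is itself a value on \<open>M\<close>. The inner product of
    \<open>S x\<close> with \<open>S (z n)\<close> is then \<open>\<mu>\<close> times and also
    \<open>v n\<close> times that of \<open>x\<close> with \<open>z n\<close>, which forces the
    latter to vanish.\<close>
  define \<mu> where "\<mu> = (norm (blinfun_apply S x))\<^sup>2"
  have v_mu: "v n < \<mu>" for n
  proof -
    have "v (Suc n) \<le> \<mu>"
      using power_mono[OF max[OF zM z(2)] norm_ge_zero, of "Suc n" 2] by (simp add: z(3) \<mu>_def)
    moreover have "v n < v (Suc n)" using e by (simp add: v_def field_simps)
    ultimately show ?thesis by simp
  qed
  have le: "inner (blinfun_apply S y) (blinfun_apply S y) \<le> \<mu> * (norm y)\<^sup>2" if y: "y \<in> M" for y
  proof (cases "y = 0")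
    case False
    then have "norm (blinfun_apply S (inverse (norm y) *\<^sub>R y)) \<le> norm (blinfun_apply S x)"
      using y sM by (intro max) (simp_all add: subspace_scale)
    then have "norm (blinfun_apply S y) \<le> norm (blinfun_apply S x) * norm y"
      using False by (simp add: blinfun.scaleR_right field_simps)
    then show ?thesis
      using power_mono[of "norm (blinfun_apply S y)" "norm (blinfun_apply S x) * norm y" 2]
      by (simp add: power2_norm_eq_inner[symmetric] \<mu>_def power_mult_distrib)
  qed simp
  have eq: "inner (blinfun_apply S x) (blinfun_apply S y) = \<mu> * inner x y" if "y \<in> M" for y
    by (rule quadratic_form_maximizer_eq[OF bounded_bilinear_inner_blinfun inner_commute sM le x _ that])
      (simp_all add: \<mu>_def power2_norm_eq_inner)
  \<comment> \<open>This turns the real first-order condition into a complex one: a vector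
    orthogonal to a complex subspace in the real sense is so in the complex sense.\<close>
  have "ad (blinfun_apply S x) - \<mu> *\<^sub>R x \<in> perp M"
  proof (rule perpI_inner)
    show "complex_vector.subspace M" by (simp add: M_def csubspace_perp)
    fix y assume "y \<in> M"
    have "inner y (ad (blinfun_apply S x)) = inner (blinfun_apply S y) (blinfun_apply S x)"
      using ad[of y "blinfun_apply S x"] by (metis Re_cinner)
    then have "inner (ad (blinfun_apply S x)) y = \<mu> * inner x y"
      using eq[OF \<open>y \<in> M\<close>] by (metis inner_commute)
    then show "inner (ad (blinfun_apply S x) - \<mu> *\<^sub>R x) y = 0" by (simp add: inner_diff_left)
  qed
  then have "cinner (z n) (ad (blinfun_apply S x) - \<mu> *\<^sub>R x) = 0" for n
    using zM cinner_eq_zero_commute by (auto simp: perp_def)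
  then have "cinner (blinfun_apply S (z n)) (blinfun_apply S x) = complex_of_real \<mu> * cinner (z n) x" for n
    by (simp add: cinner.diff_right cinner.scaleR_right ad[symmetric] scaleR_conv_of_real)
  then have eq': "cinner (blinfun_apply S x) (blinfun_apply S (z n)) = complex_of_real \<mu> * cinner x (z n)" for n
    by (metis cinner_commute complex_cnj_complex_of_real complex_cnj_mult)
  have "cinner x (z n) = 0" for n
    using eq'[of n] diag[OF x(1), of n] v_mu[of n] by simp
  then have "x \<in> perp (range z)" by (simp add: perp_def)
  then have "x = 0" using x(1) unfolding M_def by (rule perp_self_zero)
  then show False using x(2) by simp
qed

section \<open>Positive limits of absolutely norm attaining operators\<close>

text \<open>A small perturbation in operator norm changes the squared norm of an image by a small
  multiple of \<open>(norm x)\<^sup>2\<close>, hence the essential value by a small amount; so the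
  bound passes from a nearby \<open>S\<close> to \<open>T\<close>.\<close>

lemma AN_ops_closure_essential_lower:
  fixes T :: "'a::complex_hilbert \<Rightarrow>\<^sub>L 'a"
  assumes inf: "infinite_dimensional TYPE('a)" and T: "T \<in> closure AN_ops" and e: "e > 0"
  shows "\<exists>F. finite F \<and>
    (\<forall>x\<in>perp F. (essential_sq_norm T - e) * (norm x)\<^sup>2 \<le> (norm (blinfun_apply T x))\<^sup>2)"
proof -
  \<comment> \<open>Four losses of size \<open>\<delta>\<close>: two in comparing the essential
    values, one in the lower bound for \<open>S\<close>, one in returning to
    \<open>T\<close>.\<close>
  define \<delta> where "\<delta> = e / 4"
  have \<delta>: "\<delta> > 0" using e by (simp add: \<delta>_def)
  \<comment> \<open>The difference of squares factors into a difference of at most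
    \<open>d * norm x\<close> and a sum of at most \<open>(2 * norm T + 1) * norm x\<close>; capping
    \<open>d\<close> at 1 supplies the summand 1.\<close>
  define d where "d = min 1 (\<delta> / (2 * norm T + 1))"
  have tn: "2 * norm T + 1 > 0" using norm_ge_zero[of T] by linarith
  then have d: "d > 0" "d \<le> 1" "d \<le> \<delta> / (2 * norm T + 1)"
    using \<delta> by (simp_all add: d_def)
  then have d\<delta>: "d * (2 * norm T + 1) \<le> \<delta>" using tn by (simp add: field_simps)
  obtain S where S: "S \<in> AN_ops" "dist S T < d"
    using T d(1) closure_approachable by metis
  have close: "\<bar>(norm (blinfun_apply T x))\<^sup>2 - (norm (blinfun_apply S x))\<^sup>2\<bar> \<le> \<delta> * (norm x)\<^sup>2" for x
  proof -
    have a: "\<bar>norm (blinfun_apply T x) - norm (blinfun_apply S x)\<bar> \<le> d * norm x"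
    proof -
      have "\<bar>norm (blinfun_apply T x) - norm (blinfun_apply S x)\<bar>
          \<le> norm (blinfun_apply (T - S) x)"
        by (simp add: blinfun.diff_left norm_triangle_ineq3)
      also have "\<dots> \<le> norm (T - S) * norm x" by (rule norm_blinfun)
      also have "\<dots> \<le> d * norm x"
        using S(2) by (intro mult_right_mono) (simp_all add: dist_norm norm_minus_commute)
      finally show ?thesis .
    qed
    have "norm (blinfun_apply T x) \<le> norm T * norm x" by (rule norm_blinfun)
    moreover have "d * norm x \<le> 1 * norm x" using d by (intro mult_right_mono) auto
    ultimately have b: "norm (blinfun_apply T x) + norm (blinfun_apply S x) \<le> (2 * norm T + 1) * norm x"
      using a by (simp add: algebra_simps)
    have "\<bar>(norm (blinfun_apply T x))\<^sup>2 - (norm (blinfun_apply S x))\<^sup>2\<bar>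
        = \<bar>norm (blinfun_apply T x) - norm (blinfun_apply S x)\<bar>
          * (norm (blinfun_apply T x) + norm (blinfun_apply S x))"
      by (simp add: power2_eq_square square_diff_square_factored abs_mult mult.commute)
    also have "\<dots> \<le> (d * norm x) * ((2 * norm T + 1) * norm x)"
      using a b d(1) by (intro mult_mono) auto
    also have "\<dots> = (d * (2 * norm T + 1)) * (norm x)\<^sup>2" by (simp add: power2_eq_square)
    also have "\<dots> \<le> \<delta> * (norm x)\<^sup>2" using d\<delta> by (intro mult_right_mono) auto
    finally show ?thesis .
  qed
  obtain F where F: "finite F"
    "\<forall>x\<in>perp F. (norm (blinfun_apply S x))\<^sup>2 \<le> (essential_sq_norm S + \<delta>) * (norm x)\<^sup>2"
    using essential_sq_norm_upper[OF inf \<delta>, of S] by (elim exE conjE)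
  have TS: "essential_sq_norm T \<le> essential_sq_norm S + 2 * \<delta>"
  proof (rule essential_sq_norm_le[OF inf F(1)])
    fix x assume "x \<in> perp F"
    then have "(norm (blinfun_apply S x))\<^sup>2 \<le> (essential_sq_norm S + \<delta>) * (norm x)\<^sup>2" using F(2) by blast
    then show "(norm (blinfun_apply T x))\<^sup>2 \<le> (essential_sq_norm S + 2 * \<delta>) * (norm x)\<^sup>2"
      using close[of x] by (simp add: algebra_simps)
  qed
  obtain G where G: "finite G"
    "\<forall>x\<in>perp G. (essential_sq_norm S - \<delta>) * (norm x)\<^sup>2 \<le> (norm (blinfun_apply S x))\<^sup>2"
    using AN_ops_essential_lower[OF inf S(1) \<delta>] by (elim exE conjE)
  have "(essential_sq_norm T - e) * (norm x)\<^sup>2 \<le> (norm (blinfun_apply T x))\<^sup>2" if "x \<in> perp G" for x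
  proof -
    have "(essential_sq_norm T - e) * (norm x)\<^sup>2 \<le> (essential_sq_norm S - 2 * \<delta>) * (norm x)\<^sup>2"
      using TS by (intro mult_right_mono) (simp_all add: \<delta>_def)
    moreover have "(essential_sq_norm S - \<delta>) * (norm x)\<^sup>2 \<le> (norm (blinfun_apply S x))\<^sup>2"
      using G(2) that by blast
    ultimately show ?thesis using close[of x] by (simp add: algebra_simps)
  qed
  then show ?thesis using G(1) by blast
qed

section \<open>Self-adjoint and positive operators through the real inner product\<close>

lemma self_adjoint_cinner:
  "self_adjoint T \<Longrightarrow> cinner (blinfun_apply T x) y = cinner x (blinfun_apply T y)"
  by (simp add: self_adjoint_def is_adjoint_def)

lemma self_adjoint_bounded_ops: "self_adjoint T \<Longrightarrow> T \<in> bounded_ops"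
  by (simp add: self_adjoint_def)

lemma self_adjoint_simps [simp]:
  "self_adjoint id_blinfun"
  "self_adjoint S \<Longrightarrow> self_adjoint T \<Longrightarrow> self_adjoint (S + T)"
  "self_adjoint S \<Longrightarrow> self_adjoint T \<Longrightarrow> self_adjoint (S - T)"
  "self_adjoint T \<Longrightarrow> self_adjoint (- T)"
  "self_adjoint T \<Longrightarrow> self_adjoint (r *\<^sub>R T)"
  "self_adjoint T \<Longrightarrow> self_adjoint (T o\<^sub>L T)"
  by (auto simp: self_adjoint_def is_adjoint_def blinfun.bilinear_simps cinner.add_left
      cinner.add_right cinner.diff_left cinner.diff_right cinner.minus_left cinner.minus_right
      cinner.scaleR_left cinner.scaleR_right)

lemma positive_op_iff:
  "positive_op T \<longleftrightarrow> self_adjoint T \<and> (\<forall>x. 0 \<le> inner (blinfun_apply T x) x)"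
proof -
  have "Im (cinner (blinfun_apply T x) x) = 0" if "self_adjoint T" for x
    using arg_cong[OF cinner_commute[of "blinfun_apply T x" x], of Im]
    by (simp add: self_adjoint_cinner[OF that])
  then show ?thesis
    by (auto simp: positive_op_def complex_nonneg_Reals_iff Re_cinner)
qed

lemma positive_op_self_adjoint: "positive_op T \<Longrightarrow> self_adjoint T"
  and positive_op_inner: "positive_op T \<Longrightarrow> 0 \<le> inner (blinfun_apply T x) x"
  by (simp_all add: positive_op_iff)

text \<open>Polarisation, as in the proof that a self-adjoint operator has its numerical radius as
  norm. It is applied to \<open>x\<close> and a multiple of \<open>C x\<close> of the same norm, so
  the constraints \<open>C F\<close> are added to keep \<open>C x\<close> in
  \<open>perp F\<close>.\<close>

lemma small_quadratic_form_imp_small: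
  assumes C: "self_adjoint C"
    and small: "\<And>x. x \<in> perp F \<Longrightarrow> \<bar>inner (blinfun_apply C x) x\<bar> \<le> e * (norm x)\<^sup>2"
    and x: "x \<in> perp (F \<union> blinfun_apply C ` F)"
  shows "norm (blinfun_apply C x) \<le> e * norm x"
proof (cases "blinfun_apply C x = 0 \<or> x = 0")
  case True
  have "0 \<le> e * norm x" if "x \<noteq> 0"
  proof -
    have "x \<in> perp F" using x by (auto simp: perp_def)
    then have "0 \<le> e * (norm x)\<^sup>2" using small[of x] by linarith
    then show ?thesis using that by (simp add: zero_le_mult_iff)
  qed
  then show ?thesis using True by (cases "x = 0") auto
next
  case False
  define s where "s = norm x / norm (blinfun_apply C x)"
  define y where "y = s *\<^sub>R blinfun_apply C x"
  have sN: "subspace (perp F)" by (rule csubspace_imp_subspace[OF csubspace_perp])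
  have xF: "x \<in> perp F" using x by (auto simp: perp_def)
  have "blinfun_apply C x \<in> perp F" using x by (auto simp: perp_def self_adjoint_cinner[OF C])
  then have yF: "y \<in> perp F" unfolding y_def using sN by (simp add: subspace_scale)
  have ny: "norm y = norm x" using False by (simp add: y_def s_def)
  have "inner (blinfun_apply C x) y = norm x * norm (blinfun_apply C x)"
    using False by (simp add: y_def s_def dot_square_norm power2_eq_square)
  moreover have "inner (blinfun_apply C y) x = inner (blinfun_apply C x) y"
    by (metis self_adjoint_inner[OF C] inner_commute)
  then have "4 * inner (blinfun_apply C x) y =
      inner (blinfun_apply C (x + y)) (x + y) - inner (blinfun_apply C (x - y)) (x - y)"
    by (simp add: blinfun.add_right blinfun.diff_right inner_add_left inner_add_right
        inner_diff_left inner_diff_right)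
  moreover have "\<bar>inner (blinfun_apply C (x + y)) (x + y)\<bar> \<le> e * (norm (x + y))\<^sup>2"
    "\<bar>inner (blinfun_apply C (x - y)) (x - y)\<bar> \<le> e * (norm (x - y))\<^sup>2"
    using sN xF yF by (auto intro!: small simp: subspace_add subspace_diff)
  moreover have "e * (norm (x + y))\<^sup>2 + e * (norm (x - y))\<^sup>2 = 4 * e * (norm x)\<^sup>2"
  proof -
    have "(norm (x + y))\<^sup>2 + (norm (x - y))\<^sup>2 = 2 * (norm x)\<^sup>2 + 2 * (norm y)\<^sup>2"
      by (simp add: power2_norm_eq_inner algebra_simps inner_commute)
    then have "(norm (x + y))\<^sup>2 + (norm (x - y))\<^sup>2 = 4 * (norm x)\<^sup>2" using ny by simp
    then show ?thesis by (simp add: distrib_left[symmetric])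
  qed
  ultimately have "norm x * norm (blinfun_apply C x) \<le> e * (norm x)\<^sup>2" by linarith
  then have "norm x * norm (blinfun_apply C x) \<le> norm x * (e * norm x)"
    by (simp add: power2_eq_square mult.left_commute)
  then show ?thesis using False by simp
qed

text \<open>On a finite-codimensional subspace the form of T^2 - \<beta> I lies between -e and e
  times the squared norm: the definition of the essential value gives one side, the bound inherited
  from nearby operators the other. Since this operator is self-adjoint, a small form means a small
  operator.\<close>

lemma positive_op_in_closure_AN_ops:
  fixes T :: "'a::complex_hilbert \<Rightarrow>\<^sub>L 'a"
  assumes inf: "infinite_dimensional TYPE('a)" and T: "T \<in> closure AN_ops" "positive_op T"
  obtains \<alpha> where "\<alpha> \<ge> 0" "T - \<alpha> *\<^sub>R id_blinfun \<in> compact_ops"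
proof -
  define \<beta> where "\<beta> = essential_sq_norm T"
  have \<beta>: "\<beta> \<ge> 0" unfolding \<beta>_def by (rule essential_sq_norm_nonneg[OF inf])
  have sT: "self_adjoint T" using T(2) by (rule positive_op_self_adjoint)
  define C where "C = (T o\<^sub>L T) - \<beta> *\<^sub>R id_blinfun"
  have sC: "self_adjoint C" unfolding C_def using sT by simp
  have C: "C \<in> compact_ops"
  proof (rule compact_op_if_small_on_perp[OF self_adjoint_bounded_ops[OF sC]])
    fix e :: real assume e: "e > 0"
    obtain F where F: "finite F"
      "\<forall>x\<in>perp F. (norm (blinfun_apply T x))\<^sup>2 \<le> (\<beta> + e) * (norm x)\<^sup>2"
      using essential_sq_norm_upper[OF inf e, of T] unfolding \<beta>_def by (elim exE conjE)
    obtain G where G: "finite G"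
      "\<forall>x\<in>perp G. (\<beta> - e) * (norm x)\<^sup>2 \<le> (norm (blinfun_apply T x))\<^sup>2"
      using AN_ops_closure_essential_lower[OF inf T(1) e] unfolding \<beta>_def by (elim exE conjE)
    define H where "H = F \<union> G"
    have "\<bar>inner (blinfun_apply C x) x\<bar> \<le> e * (norm x)\<^sup>2" if "x \<in> perp H" for x
    proof -
      have "x \<in> perp F" "x \<in> perp G" using that by (auto simp: H_def perp_def)
      then have "(norm (blinfun_apply T x))\<^sup>2 \<le> (\<beta> + e) * (norm x)\<^sup>2"
        "(\<beta> - e) * (norm x)\<^sup>2 \<le> (norm (blinfun_apply T x))\<^sup>2" using F(2) G(2) by blast+
      moreover have "inner (blinfun_apply C x) x = (norm (blinfun_apply T x))\<^sup>2 - \<beta> * (norm x)\<^sup>2"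
        by (simp add: C_def blinfun.bilinear_simps inner_diff_left self_adjoint_inner[OF sT]
            power2_norm_eq_inner)
      ultimately show ?thesis by (simp add: abs_le_iff algebra_simps)
    qed
    then have "\<forall>x\<in>perp (H \<union> blinfun_apply C ` H). norm (blinfun_apply C x) \<le> e * norm x"
      by (intro ballI small_quadratic_form_imp_small[OF sC])
    moreover have "finite (H \<union> blinfun_apply C ` H)" using F(1) G(1) by (simp add: H_def)
    ultimately show "\<exists>F. finite F \<and> (\<forall>x\<in>perp F. norm (blinfun_apply C x) \<le> e * norm x)"
      by (intro exI conjI)
  qed
  define \<alpha> where "\<alpha> = sqrt \<beta>"
  define D where "D = T - \<alpha> *\<^sub>R id_blinfun"
  have \<alpha>: "\<alpha> \<ge> 0" "\<alpha> * \<alpha> = \<beta>" using \<beta> by (simp_all add: \<alpha>_def)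
  have D: "D \<in> bounded_ops" using self_adjoint_bounded_ops[OF sT] by (simp add: D_def)
  \<comment> \<open>Since T + \<alpha> I is at least \<alpha> I, \<open>\<alpha>\<close> times the
    squared norm of \<open>D x\<close> is at most the product of the norms of \<open>C x\<close> and
    \<open>D x\<close>. If \<open>\<alpha> = 0\<close>, then \<open>D = T\<close> and Cauchy-Schwarz
    gives the constant 1.\<close>
  define c where "c = (if \<alpha> = 0 then 1 else norm D / \<alpha>)"
  have "D \<in> compact_ops"
  proof (rule compact_op_if_dominated[OF C D, of c])
    fix x
    show "(norm (blinfun_apply D x))\<^sup>2 \<le> c * norm (blinfun_apply C x) * norm x"
    proof (cases "\<alpha> = 0")
      case True
      then have "(norm (blinfun_apply D x))\<^sup>2 = inner (blinfun_apply C x) x"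
        using \<alpha>(2) by (simp add: D_def C_def power2_norm_eq_inner self_adjoint_inner[OF sT])
      then show ?thesis using norm_cauchy_schwarz[of "blinfun_apply C x" x] True by (simp add: c_def)
    next
      case False
      define y where "y = blinfun_apply D x"
      have Cx: "blinfun_apply C x = blinfun_apply T y + \<alpha> *\<^sub>R y"
        by (simp add: C_def y_def D_def blinfun.diff_left blinfun.diff_right blinfun.scaleR_left
            blinfun.scaleR_right scaleR_diff_right \<alpha>(2))
      have "\<alpha> * (norm y)\<^sup>2 \<le> inner (blinfun_apply C x) y"
        using positive_op_inner[OF T(2), of y]
        by (simp add: Cx inner_add_left power2_norm_eq_inner)
      also have "\<dots> \<le> norm (blinfun_apply C x) * norm y" by (rule norm_cauchy_schwarz)
      also have "\<dots> \<le> norm (blinfun_apply C x) * (norm D * norm x)"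
        unfolding y_def by (intro mult_left_mono norm_blinfun) auto
      finally have "\<alpha> * (norm y)\<^sup>2 \<le> \<alpha> * (c * norm (blinfun_apply C x) * norm x)"
        using False by (simp add: c_def mult_ac)
      then show ?thesis using False \<alpha>(1) by (simp add: y_def)
    qed
  qed
  then show ?thesis using that[OF \<alpha>(1)] by (simp add: D_def)
qed

text \<open>Uniqueness of the orthogonal decomposition makes the pointwise choice linear, and
  Pythagoras bounds it by 1.\<close>

lemma projection_operator_exists:
  fixes N :: "'a::complex_hilbert set"
  assumes N: "complex_vector.subspace N" "closed N"
  obtains Q where "Q \<in> bounded_ops" "\<And>x. blinfun_apply Q x \<in> N"
    "\<And>x. x - blinfun_apply Q x \<in> perp N"
proof -
  obtain q where q: "\<And>x. q x \<in> N" "\<And>x. x - q x \<in> perp N"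
    using projection_exists[OF N] by metis
  note sub = complex_vector.subspace_add complex_vector.subspace_diff complex_vector.subspace_scale
  have uniq: "q x = y" if y: "y \<in> N" "x - y \<in> perp N" for x y
  proof -
    have "q x - y \<in> N" using q(1) y(1) N(1) by (rule sub(2)[rotated])
    moreover have "q x - y = (x - y) - (x - q x)" by simp
    then have "q x - y \<in> perp N" using sub(2)[OF csubspace_perp y(2) q(2)] by metis
    ultimately have "q x - y = 0" by (rule perp_self_zero)
    then show ?thesis by simp
  qed
  have add: "q (x + y) = q x + q y" for x y
  proof (rule uniq)
    show "q x + q y \<in> N" using sub(1)[OF N(1) q(1) q(1)] .
    have "(x + y) - (q x + q y) = (x - q x) + (y - q y)" by simp
    then show "(x + y) - (q x + q y) \<in> perp N" using sub(1)[OF csubspace_perp q(2) q(2)] by metis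
  qed
  have scaleC: "q (c *\<^sub>C x) = c *\<^sub>C q x" for c x
  proof (rule uniq)
    show "c *\<^sub>C q x \<in> N" using sub(3)[OF N(1) q(1)] .
    show "c *\<^sub>C x - c *\<^sub>C q x \<in> perp N"
      using sub(3)[OF csubspace_perp q(2)] by (metis scaleC_diff_right)
  qed
  have "bounded_linear q"
  proof (rule bounded_linear_intro[of _ 1])
    show "q (r *\<^sub>R x) = r *\<^sub>R q x" for r x
      using scaleC[of "complex_of_real r" x] by (simp add: scaleC_of_real)
    fix x
    have "cinner (x - q x) (q x) = 0" using q unfolding perp_def by blast
    then have "inner (x - q x) (q x) = 0" using Re_cinner[of "x - q x" "q x"] by simp
    then have "(norm x)\<^sup>2 = (norm (x - q x))\<^sup>2 + (norm (q x))\<^sup>2"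
      unfolding power2_norm_eq_inner by (simp add: inner_diff_left inner_diff_right inner_commute)
    then have "(norm (q x))\<^sup>2 \<le> (norm x)\<^sup>2" by simp
    then show "norm (q x) \<le> norm x * 1" using power2_le_imp_le[of "norm (q x)" "norm x"] by simp
  qed (rule add)
  then have Q: "blinfun_apply (Blinfun q) x = q x" for x by (simp add: bounded_linear_Blinfun_apply)
  show ?thesis
  proof (rule that)
    show "Blinfun q \<in> bounded_ops" by (rule bounded_opsI[OF Q scaleC])
    show "blinfun_apply (Blinfun q) x \<in> N" "x - blinfun_apply (Blinfun q) x \<in> perp N" for x
      unfolding Q by (rule q)+
  qed
qed

section \<open>The compact decomposition\<close>

text \<open>The complement is invariant under \<open>K\<close>. A positive value of the form there
  would yield an eigenvector in it with positive eigenvalue, which would be orthogonal to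
  itself.\<close>

lemma compact_self_adjoint_nonpos_on_perp:
  fixes K :: "'a::complex_hilbert \<Rightarrow>\<^sub>L 'a"
  assumes K: "K \<in> compact_ops" "self_adjoint K"
    and x: "x \<in> perp {e. \<exists>\<mu>>0. blinfun_apply K e = \<mu> *\<^sub>R e}" (is "x \<in> perp ?E")
  shows "inner (blinfun_apply K x) x \<le> 0"
proof (rule ccontr)
  assume "\<not> ?thesis"
  then have pos: "inner (blinfun_apply K x) x > 0" by simp
  have inv: "blinfun_apply K y \<in> perp ?E" if y: "y \<in> perp ?E" for y
    unfolding perp_def
  proof (intro CollectI ballI)
    fix e assume e: "e \<in> ?E"
    then obtain \<mu> where "blinfun_apply K e = \<mu> *\<^sub>R e" by blast
    moreover have "cinner y e = 0" using y e unfolding perp_def by blast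
    ultimately show "cinner (blinfun_apply K y) e = 0"
      by (simp add: self_adjoint_cinner[OF K(2)] cinner.scaleR_right)
  qed
  obtain \<mu> e where e: "\<mu> > 0" "e \<in> perp ?E" "norm e = 1" "blinfun_apply K e = \<mu> *\<^sub>R e"
    using positive_eigenvector_exists[OF K csubspace_imp_subspace[OF csubspace_perp] closed_perp
        inv x pos] .
  have "e \<in> ?E" using e(1,4) by blast
  then have "e = 0" using e(2) by (rule perp_self_zero)
  then show False using e(3) by simp
qed

lemma self_adjoint_inner_zero:
  assumes "self_adjoint D" "\<And>x. inner (blinfun_apply D x) x = 0"
  shows "D = 0"
proof (rule blinfun_eqI)
  fix x
  have "inner (blinfun_apply D x) (blinfun_apply D x) = 0"
  proof (rule semidefinite_form_zero[where b = "\<lambda>x y. inner (blinfun_apply D x) y" and N = UNIV])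
    show "inner (blinfun_apply D y) z = inner (blinfun_apply D z) y" for y z
      by (metis self_adjoint_inner[OF assms(1)] inner_commute)
  qed (simp_all add: assms(2) blinfun.add_right blinfun.scaleR_right inner_add_left)
  then show "blinfun_apply D x = blinfun_apply 0 x" by simp
qed

lemma self_adjoint_compose_zero_commute:
  assumes "self_adjoint A" "self_adjoint B" "A o\<^sub>L B = 0"
  shows "B o\<^sub>L A = 0"
proof (rule blinfun_eqI)
  fix x
  let ?y = "blinfun_apply B (blinfun_apply A x)"
  have "inner ?y ?y = inner x (blinfun_apply (A o\<^sub>L B) ?y)"
    by (simp add: self_adjoint_inner[OF assms(2)] self_adjoint_inner[OF assms(1)])
  then show "blinfun_apply (B o\<^sub>L A) x = blinfun_apply 0 x" by (simp add: assms(3))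
qed

text \<open>
  $N$ is the orthogonal complement of the eigenvectors of $K$ for positive eigenvalues; it contains
  those for negative eigenvalues, so $K$ is negative on $N$ and positive on its complement.
\<close>

lemma compact_self_adjoint_decomposition:
  fixes K :: "'a::complex_hilbert \<Rightarrow>\<^sub>L 'a"
  assumes K: "K \<in> compact_ops" "self_adjoint K"
    and lower: "\<And>x. - \<alpha> * (norm x)\<^sup>2 \<le> inner (blinfun_apply K x) x" and \<alpha>: "\<alpha> \<ge> 0"
  obtains K1 K2 where "K1 \<in> compact_ops" "positive_op K1" "K2 \<in> compact_ops" "positive_op K2"
    "K = K2 - K1" "K1 o\<^sub>L K2 = 0" "op_le K1 (\<alpha> *\<^sub>R id_blinfun)"
proof -
  define E where "E = {e. \<exists>\<mu>>0. blinfun_apply K e = \<mu> *\<^sub>R e}"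
  define E' where "E' = {e. \<exists>\<mu>>0. blinfun_apply (- K) e = \<mu> *\<^sub>R e}"
  define N where "N = perp E"
  have cN: "complex_vector.subspace N" "closed N"
    by (simp_all add: N_def csubspace_perp closed_perp)
  have neg: "inner (blinfun_apply K x) x \<le> 0" if "x \<in> N" for x
    using compact_self_adjoint_nonpos_on_perp[OF K] that by (simp add: N_def E_def)
  \<comment> \<open>Eigenvectors of a self-adjoint operator for eigenvalues of opposite sign are
    orthogonal.\<close>
  have "E' \<subseteq> N"
    unfolding N_def perp_def
  proof (intro subsetI CollectI ballI)
    fix e f assume "e \<in> E'" "f \<in> E"
    obtain \<mu> where \<mu>: "\<mu> > 0" "blinfun_apply (- K) e = \<mu> *\<^sub>R e"
      using \<open>e \<in> E'\<close> unfolding E'_def by blast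
    obtain \<nu> where \<nu>: "\<nu> > 0" "blinfun_apply K f = \<nu> *\<^sub>R f"
      using \<open>f \<in> E\<close> unfolding E_def by blast
    have "blinfun_apply K e = - (\<mu> *\<^sub>R e)" using \<mu>(2) by (metis blinfun.minus_left minus_minus)
    then have "- (\<mu> *\<^sub>R cinner e f) = \<nu> *\<^sub>R cinner e f"
      using self_adjoint_cinner[OF K(2), of e f]
      by (simp add: \<nu>(2) cinner.minus_left cinner.scaleR_left cinner.scaleR_right)
    then have "(\<mu> + \<nu>) *\<^sub>R cinner e f = 0"
      by (metis add.right_inverse scaleR_add_left)
    then show "cinner e f = 0" using \<mu>(1) \<nu>(1) by simp
  qed
  then have "perp N \<subseteq> perp E'" by (rule perp_anti_mono)
  have "- K \<in> compact_ops" using compact_ops_scaleR[OF K(1), of "-1"] by simp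
  have pos: "0 \<le> inner (blinfun_apply K x) x" if "x \<in> perp N" for x
    using compact_self_adjoint_nonpos_on_perp[OF \<open>- K \<in> compact_ops\<close>, of x] K(2) that
      \<open>perp N \<subseteq> perp E'\<close>
    by (auto simp: E'_def blinfun.minus_left)
  obtain Q where Q: "Q \<in> bounded_ops" "\<And>x. blinfun_apply Q x \<in> N"
    "\<And>x. x - blinfun_apply Q x \<in> perp N"
    by (rule projection_operator_exists[OF cN]) blast
  have zero: "cinner y x = 0" "cinner x y = 0" if "x \<in> N" "y \<in> perp N" for x y
    using that cinner_eq_zero_commute unfolding perp_def by blast+
  have K_N: "blinfun_apply K x \<in> N" if "x \<in> N" for x
    unfolding N_def perp_def
  proof (intro CollectI ballI)
    fix e assume e: "e \<in> E"
    then obtain \<mu> where "blinfun_apply K e = \<mu> *\<^sub>R e" unfolding E_def by blast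
    moreover have "cinner x e = 0" using that e unfolding N_def perp_def by blast
    ultimately show "cinner (blinfun_apply K x) e = 0"
      by (simp add: self_adjoint_cinner[OF K(2)] cinner.scaleR_right)
  qed
  have K_perp: "blinfun_apply K y \<in> perp N" if "y \<in> perp N" for y
    unfolding perp_def
    using zero(1)[OF K_N that] by (simp add: self_adjoint_cinner[OF K(2)])
  have Q_uniq: "blinfun_apply Q x = y" if "y \<in> N" "x - y \<in> perp N" for x y
  proof -
    have "blinfun_apply Q x - y \<in> N" using Q(2) that(1) cN(1) complex_vector.subspace_diff by blast
    moreover have "(x - y) - (x - blinfun_apply Q x) \<in> perp N"
      by (rule complex_vector.subspace_diff[OF csubspace_perp that(2) Q(3)])
    then have "blinfun_apply Q x - y \<in> perp N" by simp
    ultimately have "blinfun_apply Q x - y = 0" by (rule perp_self_zero)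
    then show ?thesis by simp
  qed
  \<comment> \<open>Both \<open>N\<close> and its complement are invariant under \<open>K\<close>,
    so uniqueness of the decomposition makes the projection commute with \<open>K\<close>.\<close>
  have QK: "blinfun_apply Q (blinfun_apply K x) = blinfun_apply K (blinfun_apply Q x)" for x
    by (rule Q_uniq[OF K_N[OF Q(2)]]) (use K_perp[OF Q(3)] in \<open>simp add: blinfun.diff_right\<close>)
  have QQ: "blinfun_apply Q (blinfun_apply Q x) = blinfun_apply Q x" for x
    by (rule Q_uniq[OF Q(2)]) (simp add: perp_def)
  have sQ: "cinner (blinfun_apply Q x) y = cinner x (blinfun_apply Q y)" for x y
    using zero(2)[OF Q(2)[of x] Q(3)[of y]] zero(1)[OF Q(2)[of y] Q(3)[of x]]
    by (simp add: cinner.diff_left cinner.diff_right)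
  define K1 where "K1 = - (K o\<^sub>L Q)"
  define K2 where "K2 = K - (K o\<^sub>L Q)"
  have KQ: "K o\<^sub>L Q \<in> compact_ops" by (rule compact_ops_compose_right[OF K(1) Q(1)])
  have sKQ: "self_adjoint (K o\<^sub>L Q)"
    using compact_ops_bounded_ops[OF KQ]
    by (simp add: self_adjoint_def is_adjoint_def self_adjoint_cinner[OF K(2)] sQ QK)
  have K1_apply: "blinfun_apply K1 x = - blinfun_apply K (blinfun_apply Q x)" for x
    by (simp add: K1_def blinfun.minus_left)
  have K2_apply: "blinfun_apply K2 x = blinfun_apply K (x - blinfun_apply Q x)" for x
    by (simp add: K2_def blinfun.diff_left blinfun.diff_right)
  have inner_zero: "inner x y = 0" "inner y x = 0" if "x \<in> N" "y \<in> perp N" for x y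
    using zero[OF that] Re_cinner[of x y] Re_cinner[of y x] by simp_all
  have K1_inner: "inner (blinfun_apply K1 x) x = - inner (blinfun_apply K (blinfun_apply Q x)) (blinfun_apply Q x)" for x
    using inner_zero(1)[OF K_N[OF Q(2)[of x]] Q(3)[of x]] by (simp add: K1_apply inner_diff_right)
  have K2_inner: "inner (blinfun_apply K2 x) x
      = inner (blinfun_apply K (x - blinfun_apply Q x)) (x - blinfun_apply Q x)" for x
    using inner_zero(2)[OF Q(2)[of x] K_perp[OF Q(3)[of x]]] unfolding K2_apply
    by (simp only: inner_diff_right)
  have K1p: "positive_op K1"
    using sKQ neg[OF Q(2)] unfolding positive_op_iff K1_inner by (simp add: K1_def)
  show ?thesis
  proof (rule that)
    show "K1 \<in> compact_ops" using compact_ops_scaleR[OF KQ, of "-1"] by (simp add: K1_def)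
    show "K2 \<in> compact_ops" unfolding K2_def by (rule compact_ops_diff[OF K(1) KQ])
    show "positive_op K1" by (rule K1p)
    show "positive_op K2"
      using sKQ K(2) pos[OF Q(3)] unfolding positive_op_iff K2_inner by (simp add: K2_def)
    show "K = K2 - K1" by (simp add: K1_def K2_def)
    show "K1 o\<^sub>L K2 = 0"
      by (rule blinfun_eqI)
        (simp add: K1_apply K2_apply QK blinfun.diff_right QQ)
    \<comment> \<open>\<open>K1\<close> only sees the component in \<open>N\<close>, where the lower
      bound on the form of \<open>K\<close> applies; Pythagoras then returns to
      \<open>x\<close>.\<close>
    show "op_le K1 (\<alpha> *\<^sub>R id_blinfun)"
      unfolding op_le_def positive_op_iff
    proof (intro conjI allI)
      show "self_adjoint K1" by (rule positive_op_self_adjoint[OF K1p])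
      then show "self_adjoint (\<alpha> *\<^sub>R id_blinfun - K1)" by simp
      fix x
      have "(norm x)\<^sup>2 = (norm (blinfun_apply Q x))\<^sup>2 + (norm (x - blinfun_apply Q x))\<^sup>2"
        using inner_zero(1)[OF Q(2)[of x] Q(3)[of x]]
        by (simp add: power2_norm_eq_inner inner_diff_left inner_diff_right inner_commute)
      then have "(norm (blinfun_apply Q x))\<^sup>2 \<le> (norm x)\<^sup>2" by simp
      then have "\<alpha> * (norm (blinfun_apply Q x))\<^sup>2 \<le> \<alpha> * (norm x)\<^sup>2" using \<alpha> by (rule mult_left_mono)
      moreover have "inner (blinfun_apply K1 x) x \<le> \<alpha> * (norm (blinfun_apply Q x))\<^sup>2"
        using lower[of "blinfun_apply Q x"] by (simp add: K1_inner)
      ultimately show "0 \<le> inner (blinfun_apply (\<alpha> *\<^sub>R id_blinfun - K1) x) x"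
        by (simp add: blinfun.diff_left blinfun.scaleR_left inner_diff_left power2_norm_eq_inner)
    qed simp
  qed
qed

section \<open>Scalar plus compact operators and their norm limits\<close>

lemma subspace_meets_perp_or_finite_span:
  fixes F :: "'a::complex_hilbert set"
  assumes "finite F" "complex_vector.subspace M"
  shows "(\<exists>x\<in>M \<inter> perp F. x \<noteq> 0) \<or> (\<exists>G. finite G \<and> M \<subseteq> complex_vector.span G)"
  using assms
proof (induction F arbitrary: M)
  case empty
  show ?case
  proof (cases "\<exists>x\<in>M. x \<noteq> 0")
    case True
    then show ?thesis by (simp add: perp_def)
  next
    case False
    then have "M \<subseteq> complex_vector.span {}" by auto
    then show ?thesis by blast
  qed
next
  case (insert f F)
  have "complex_vector.subspace (M \<inter> perp {f})"
    using insert.prems csubspace_perp by (rule complex_vector.subspace_inter)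
  from insert.IH[OF this] show ?case
  proof
    assume "\<exists>x\<in>M \<inter> perp {f} \<inter> perp F. x \<noteq> 0"
    moreover have "perp {f} \<inter> perp F = perp (insert f F)" by (auto simp: perp_def)
    ultimately show ?thesis by (simp add: Int_assoc)
  next
    assume "\<exists>G. finite G \<and> M \<inter> perp {f} \<subseteq> complex_vector.span G"
    then obtain G where G: "finite G" "M \<inter> perp {f} \<subseteq> complex_vector.span G" by blast
    show ?thesis
    proof (cases "M \<subseteq> perp {f}")
      case True
      then have "M \<subseteq> complex_vector.span G" using G(2) by blast
      then show ?thesis using G(1) by blast
    next
      case False
      then obtain m where m: "m \<in> M" "cinner m f \<noteq> 0" by (auto simp: perp_def)
      \<comment> \<open>One more constraint costs at most one dimension: \<open>m\<close> violates
        it, and subtracting the right multiple of \<open>m\<close> from \<open>y\<close> restores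
        it.\<close>
      have "y \<in> complex_vector.span (insert m G)" if y: "y \<in> M" for y
      proof -
        let ?c = "cinner y f / cinner m f"
        have "y - ?c *\<^sub>C m \<in> M"
          by (rule complex_vector.subspace_diff[OF insert.prems y
                complex_vector.subspace_scale[OF insert.prems m(1)]])
        moreover have "y - ?c *\<^sub>C m \<in> perp {f}"
          using m(2) by (simp add: perp_def cinner.diff_left cinner_scaleC_left)
        ultimately have "y - ?c *\<^sub>C m \<in> complex_vector.span G" using G(2) by blast
        then show ?thesis using complex_vector.span_breakdown_eq by blast
      qed
      then have "M \<subseteq> complex_vector.span (insert m G)" by blast
      moreover have "finite (insert m G)" using G(1) by simp
      ultimately show ?thesis by blast
    qed
  qed
qed

text \<open>The squared norm of an image differs from \<open>\<alpha>\<^sup>2\<close> times the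
  squared norm by terms that \<open>L\<close> controls, so only the supremum
  \<open>\<alpha>\<^sup>2\<close> is critical. The bound on \<open>perp F\<close> addresses that
  case: every unit vector of \<open>M\<close> in \<open>perp F\<close> is then a maximiser.\<close>

lemma AN_ops_scalar_plus_compact:
  fixes L :: "'a::complex_hilbert \<Rightarrow>\<^sub>L 'a"
  assumes \<alpha>: "\<alpha> \<ge> 0" and L: "L \<in> compact_ops" and F: "finite F"
    and ge: "\<And>x. x \<in> perp F \<Longrightarrow> \<alpha> * norm x \<le> norm (blinfun_apply (\<alpha> *\<^sub>R id_blinfun + L) x)"
  shows "\<alpha> *\<^sub>R id_blinfun + L \<in> AN_ops"
proof -
  define T where "T = \<alpha> *\<^sub>R id_blinfun + L"
  have TB: "T \<in> bounded_ops" using compact_ops_bounded_ops[OF L] by (simp add: T_def)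
  define b where "b x y = inner (blinfun_apply T x) (blinfun_apply T y)" for x y
  have bb: "bounded_bilinear b" unfolding b_def by (rule bounded_bilinear_inner_blinfun)
  have sym: "b x y = b y x" for x y by (simp add: b_def inner_commute)
  have b_norm: "b x x = (norm (blinfun_apply T x))\<^sup>2" for x by (simp add: b_def power2_norm_eq_inner)
  have "norm_attaining_on T M" if M: "complex_vector.subspace M" "closed M" "M \<noteq> {0}" for M
  proof -
    have sM: "subspace M" using M(1) by (rule csubspace_imp_subspace)
    obtain u where "u \<in> M" "u \<noteq> 0" using M(3) subspace_0[OF sM] by blast
    then have u: "inverse (norm u) *\<^sub>R u \<in> M" "norm (inverse (norm u) *\<^sub>R u) = 1"
      using sM by (simp_all add: subspace_scale)
    define \<mu> where "\<mu> = (SUP x\<in>{x \<in> M. norm x = 1}. b x x)"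
    have le: "b x x \<le> \<mu> * (norm x)\<^sup>2" if "x \<in> M" for x
      unfolding \<mu>_def by (rule quadratic_form_le_SUP[OF bb sM that])
    have "\<exists>x\<in>M. norm x = 1 \<and> b x x = \<mu>"
    proof (cases "\<mu> = \<alpha>\<^sup>2")
      case False
      show ?thesis
      proof (rule quadratic_form_max_attained_compact[OF bb sym sM M(2) u \<mu>_def False L,
            of "4 * \<alpha> + 2 * norm L"])
        fix d assume "d \<in> M" "norm d \<le> 2"
        have "b d d - \<alpha>\<^sup>2 * (norm d)\<^sup>2 = 2 * \<alpha> * inner d (blinfun_apply L d) + (norm (blinfun_apply L d))\<^sup>2"
          by (simp add: b_def T_def blinfun.add_left blinfun.scaleR_left inner_add_left inner_add_right
              power2_norm_eq_inner power2_eq_square[of \<alpha>] inner_commute)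
        also have "\<bar>\<dots>\<bar> \<le> 2 * \<alpha> * \<bar>inner d (blinfun_apply L d)\<bar> + (norm (blinfun_apply L d))\<^sup>2"
          using \<alpha> by (intro order_trans[OF abs_triangle_ineq]) (simp add: abs_mult)
        also have "\<dots> \<le> 2 * \<alpha> * (2 * norm (blinfun_apply L d)) + norm L * 2 * norm (blinfun_apply L d)"
        proof (intro add_mono mult_left_mono)
          have "norm d * norm (blinfun_apply L d) \<le> 2 * norm (blinfun_apply L d)"
            using \<open>norm d \<le> 2\<close> by (intro mult_right_mono) auto
          then show "\<bar>inner d (blinfun_apply L d)\<bar> \<le> 2 * norm (blinfun_apply L d)"
            using Cauchy_Schwarz_ineq2[of d "blinfun_apply L d"] by linarith
          have "norm L * norm d \<le> norm L * 2" using \<open>norm d \<le> 2\<close> by (intro mult_left_mono) auto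
          then have "norm (blinfun_apply L d) \<le> norm L * 2" using norm_blinfun[of L d] by linarith
          then show "(norm (blinfun_apply L d))\<^sup>2 \<le> norm L * 2 * norm (blinfun_apply L d)"
            unfolding power2_eq_square by (intro mult_right_mono) auto
        qed (use \<alpha> in simp)
        also have "\<dots> = (4 * \<alpha> + 2 * norm L) * norm (blinfun_apply L d)" by (simp add: algebra_simps)
        finally show "\<bar>b d d - \<alpha>\<^sup>2 * (norm d)\<^sup>2\<bar> \<le> (4 * \<alpha> + 2 * norm L) * norm (blinfun_apply L d)" .
      qed
    next
      case True
      from subspace_meets_perp_or_finite_span[OF F M(1)] show ?thesis
      proof
        assume "\<exists>x\<in>M \<inter> perp F. x \<noteq> 0"
        then obtain x where x: "x \<in> M" "x \<in> perp F" "x \<noteq> 0" by blast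
        define y where "y = inverse (norm x) *\<^sub>R x"
        have y: "y \<in> M" "norm y = 1" "y \<in> perp F"
          using x sM csubspace_imp_subspace[OF csubspace_perp[of F]]
          by (simp_all add: y_def subspace_scale)
        have "\<alpha> \<le> norm (blinfun_apply T y)" using ge[OF y(3)] y(2) by (simp add: T_def)
        then have "\<mu> \<le> b y y" unfolding True b_norm using \<alpha> by (rule power_mono)
        moreover have "b y y \<le> \<mu>" using le[OF y(1)] y(2) by simp
        ultimately show ?thesis using y(1,2) by (intro bexI[of _ y]) auto
      next
        assume "\<exists>G. finite G \<and> M \<subseteq> complex_vector.span G"
        then obtain G where G: "finite G" "M \<subseteq> complex_vector.span G" by blast
        obtain P where P: "P \<in> compact_ops" "\<And>x. blinfun_apply P x \<in> complex_vector.span G"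
          "\<And>x. x - blinfun_apply P x \<in> perp G" using finite_span_projection[OF G(1)] by blast
        have Pid: "blinfun_apply P d = d" if "d \<in> M" for d
        proof -
          have "d \<in> complex_vector.span G" using G(2) that by blast
          then have "d - blinfun_apply P d \<in> complex_vector.span G"
            using P(2) by (rule complex_vector.span_diff)
          then have "cinner (d - blinfun_apply P d) (d - blinfun_apply P d) = 0"
            by (rule cinner_span_zero[OF P(3)])
          then show ?thesis by (simp add: cinner_self)
        qed
        show ?thesis
        \<comment> \<open>On \<open>M\<close> the compact \<open>P\<close> is the identity and thus
          controls the squared norm. Any value other than \<open>\<mu>\<close> can serve as
          \<open>\<gamma>\<close>, here \<open>\<mu> + 1\<close>.\<close>
        proof (rule quadratic_form_max_attained_compact[OF bb sym sM M(2) u \<mu>_def _ P(1),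
              of "\<mu> + 1" "2 * (norm T)\<^sup>2 + 2 * \<bar>\<mu> + 1\<bar>"])
          fix d assume d: "d \<in> M" "norm d \<le> 2"
          have "\<bar>b d d - (\<mu> + 1) * (norm d)\<^sup>2\<bar> \<le> b d d + \<bar>\<mu> + 1\<bar> * (norm d)\<^sup>2"
            using abs_triangle_ineq4[of "b d d" "(\<mu> + 1) * (norm d)\<^sup>2"] by (simp add: b_norm abs_mult)
          also have "\<dots> \<le> (norm T)\<^sup>2 * (norm d)\<^sup>2 + \<bar>\<mu> + 1\<bar> * (norm d)\<^sup>2"
            using power_mono[OF norm_blinfun[of T d], of 2] by (simp add: b_norm power_mult_distrib)
          also have "\<dots> = ((norm T)\<^sup>2 + \<bar>\<mu> + 1\<bar>) * (norm d * norm d)"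
            by (simp add: distrib_right power2_eq_square)
          also have "\<dots> \<le> ((norm T)\<^sup>2 + \<bar>\<mu> + 1\<bar>) * (2 * norm d)"
            using d(2) by (intro mult_left_mono mult_right_mono) auto
          also have "\<dots> = (2 * (norm T)\<^sup>2 + 2 * \<bar>\<mu> + 1\<bar>) * norm (blinfun_apply P d)"
            by (simp add: Pid[OF d(1)] distrib_right)
          finally show "\<bar>b d d - (\<mu> + 1) * (norm d)\<^sup>2\<bar>
            \<le> (2 * (norm T)\<^sup>2 + 2 * \<bar>\<mu> + 1\<bar>) * norm (blinfun_apply P d)" .
        qed simp
      qed
    qed
    then obtain x where x: "x \<in> M" "norm x = 1" "b x x = \<mu>" by blast
    show ?thesis
    proof (rule norm_attaining_onI[OF x(1,2)])
      fix y assume "y \<in> M" "norm y = 1"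
      then have "(norm (blinfun_apply T y))\<^sup>2 \<le> (norm (blinfun_apply T x))\<^sup>2"
        using le[of y] x(3) by (simp add: b_norm)
      then show "norm (blinfun_apply T y) \<le> norm (blinfun_apply T x)" by (rule power2_le_imp_le) simp
    qed
  qed
  then show ?thesis using TB unfolding AN_ops_def T_def by blast
qed

text \<open>The approximant \<alpha> I + K2 - K1 P differs from \<open>T\<close> by K1 (I - P),
  which is small because K1 is small on \<open>perp F\<close>. On \<open>perp F\<close> itself
  \<open>P\<close> vanishes and the approximant is \<alpha> I + K2, where positivity of K2 gives the
  lower bound.\<close>

lemma compact_decomposition_in_closure_AN_ops:
  assumes "compact_decomposition T \<alpha> K1 K2"
  shows "T \<in> closure AN_ops"
  unfolding closure_approachable
proof (intro allI impI)
  fix e :: real assume "e > 0"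
  then have e: "e / 2 > 0" by simp
  have \<alpha>: "\<alpha> \<ge> 0" and K: "K1 \<in> compact_ops" "K2 \<in> compact_ops" "positive_op K1" "positive_op K2"
    and T: "T = \<alpha> *\<^sub>R id_blinfun - K1 + K2"
    using assms by (simp_all add: compact_decomposition_def)
  obtain F where F: "finite F" "\<forall>x\<in>perp F. norm (blinfun_apply K1 x) \<le> e / 2 * norm x"
    using compact_self_adjoint_small_on_perp[OF K(1) positive_op_self_adjoint[OF K(3)] e]
    by (elim exE conjE)
  obtain P where P: "P \<in> compact_ops" "\<And>x. blinfun_apply P x \<in> complex_vector.span F"
    "\<And>x. x - blinfun_apply P x \<in> perp F" using finite_span_projection[OF F(1)] by blast
  define L where "L = K2 - (K1 o\<^sub>L P)"
  have L: "L \<in> compact_ops"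
    unfolding L_def
    by (rule compact_ops_diff[OF K(2) compact_ops_compose_left[OF P(1) compact_ops_bounded_ops[OF K(1)]]])
  have "\<alpha> *\<^sub>R id_blinfun + L \<in> AN_ops"
  proof (rule AN_ops_scalar_plus_compact[OF \<alpha> L F(1)])
    fix x assume x: "x \<in> perp F"
    have "x - (x - blinfun_apply P x) \<in> perp F"
      by (rule complex_vector.subspace_diff[OF csubspace_perp x P(3)])
    then have "cinner (blinfun_apply P x) (blinfun_apply P x) = 0"
      using cinner_span_zero[OF _ P(2)[of x]] by simp
    then have "blinfun_apply P x = 0" by (simp add: cinner_self)
    then have ap: "blinfun_apply (\<alpha> *\<^sub>R id_blinfun + L) x = \<alpha> *\<^sub>R x + blinfun_apply K2 x"
      by (simp add: L_def blinfun.add_left blinfun.diff_left blinfun.scaleR_left)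
    show "\<alpha> * norm x \<le> norm (blinfun_apply (\<alpha> *\<^sub>R id_blinfun + L) x)"
    proof (cases "x = 0")
      case False
      have "\<alpha> * norm x * norm x \<le> inner (\<alpha> *\<^sub>R x + blinfun_apply K2 x) x"
        using positive_op_inner[OF K(4), of x]
        by (simp add: inner_add_left dot_square_norm power2_eq_square)
      also have "\<dots> \<le> norm (\<alpha> *\<^sub>R x + blinfun_apply K2 x) * norm x" by (rule norm_cauchy_schwarz)
      finally show ?thesis unfolding ap using False by simp
    qed simp
  qed
  moreover have "norm (\<alpha> *\<^sub>R id_blinfun + L - T) \<le> e / 2"
  proof (rule norm_blinfun_bound)
    fix x
    have "blinfun_apply (\<alpha> *\<^sub>R id_blinfun + L - T) x = blinfun_apply K1 (x - blinfun_apply P x)"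
      by (simp add: T L_def blinfun.add_left blinfun.diff_left blinfun.diff_right)
    also have "norm \<dots> \<le> e / 2 * norm (x - blinfun_apply P x)"
      using F(2) P(3) by blast
    also have "\<dots> \<le> e / 2 * norm x"
      using norm_minus_projection_le[OF P(2,3)] e by (intro mult_left_mono) auto
    finally show "norm (blinfun_apply (\<alpha> *\<^sub>R id_blinfun + L - T) x) \<le> e / 2 * norm x" .
  qed (use e in simp)
  then have "dist (\<alpha> *\<^sub>R id_blinfun + L) T < e" using \<open>e > 0\<close> by (simp add: dist_norm)
  ultimately show "\<exists>S\<in>AN_ops. dist S T < e" by blast
qed

section \<open>Uniqueness of positive square roots of squares of compact operators\<close>

text \<open>
  An eigenvector of $A - B$ for an eigenvalue $\mu > 0$ satisfies $Ax = Bx + \mu x$, while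
  $A^2 = B^2$ gives $\|Ax\| = \|Bx\|$; hence $2\langle Bx,x\rangle + \mu = 0$.
\<close>

lemma compact_positive_sqrt_diff_nonpos:
  fixes A B :: "'a::complex_hilbert \<Rightarrow>\<^sub>L 'a"
  assumes A: "A \<in> compact_ops" "positive_op A" and B: "B \<in> compact_ops" "positive_op B"
    and sq: "A o\<^sub>L A = B o\<^sub>L B"
  shows "inner (blinfun_apply (A - B) z) z \<le> 0"
proof (rule ccontr)
  assume "\<not> ?thesis"
  then have pos: "inner (blinfun_apply (A - B) z) z > 0" by simp
  have sa: "self_adjoint A" "self_adjoint B" using A B by (simp_all add: positive_op_self_adjoint)
  obtain \<mu> x where x: "\<mu> > 0" "norm x = 1" "blinfun_apply (A - B) x = \<mu> *\<^sub>R x"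
    using positive_eigenvector_exists[OF compact_ops_diff[OF A(1) B(1)] _ subspace_UNIV closed_UNIV
        UNIV_I UNIV_I pos] sa by auto
  have AB: "blinfun_apply A x = blinfun_apply B x + \<mu> *\<^sub>R x"
    using x(3) by (simp add: blinfun.diff_left algebra_simps)
  have "blinfun_apply A (blinfun_apply A x) = blinfun_apply B (blinfun_apply B x)"
    using arg_cong[OF sq, of "\<lambda>T. blinfun_apply T x"] by simp
  then have "inner (blinfun_apply A x) (blinfun_apply A x) = inner (blinfun_apply B x) (blinfun_apply B x)"
    by (metis self_adjoint_inner sa inner_commute)
  then have "\<mu> * (2 * inner (blinfun_apply B x) x + \<mu>) = 0"
    using x(2) by (simp add: AB inner_add_left inner_add_right inner_commute norm_eq_1 algebra_simps)
  then have "2 * inner (blinfun_apply B x) x + \<mu> = 0" using x(1) by simp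
  then show False using x(1) positive_op_inner[OF B(2), of x] by linarith
qed

text \<open>\<open>B\<close> inherits compactness, since the squared norm of \<open>B x\<close> is
  at most that of \<open>B (B x)\<close> times that of \<open>x\<close>, both unsquared. The form of
  \<open>A - B\<close> then vanishes by comparison in both orders. This evaluates the description in
  \<open>op_sqrt\<close>, whose competitors are merely positive.\<close>

lemma positive_sqrt_unique:
  assumes A: "A \<in> compact_ops" "positive_op A" and B: "positive_op B"
    and sq: "B o\<^sub>L B = A o\<^sub>L A"
  shows "B = A"
proof -
  have sa: "self_adjoint A" "self_adjoint B" using A B by (simp_all add: positive_op_self_adjoint)
  have Bc: "B \<in> compact_ops"
  proof (rule compact_op_if_dominated[where c = 1])
    show "A o\<^sub>L A \<in> compact_ops"
      by (rule compact_ops_compose_left[OF A(1) self_adjoint_bounded_ops[OF sa(1)]])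
    show "B \<in> bounded_ops" by (rule self_adjoint_bounded_ops[OF sa(2)])
    fix x
    have "(norm (blinfun_apply B x))\<^sup>2 = inner x (blinfun_apply (B o\<^sub>L B) x)"
      by (simp add: power2_norm_eq_inner self_adjoint_inner[OF sa(2)])
    also have "\<dots> \<le> norm x * norm (blinfun_apply (B o\<^sub>L B) x)" by (rule norm_cauchy_schwarz)
    finally show "(norm (blinfun_apply B x))\<^sup>2 \<le> 1 * norm (blinfun_apply (A o\<^sub>L A) x) * norm x"
      by (simp add: sq mult.commute)
  qed
  have "A - B = 0"
  proof (rule self_adjoint_inner_zero)
    show "self_adjoint (A - B)" using sa by simp
    fix x
    have "inner (blinfun_apply (A - B) x) x \<le> 0" "inner (blinfun_apply (B - A) x) x \<le> 0"
      using compact_positive_sqrt_diff_nonpos[OF A Bc B sq[symmetric]]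
        compact_positive_sqrt_diff_nonpos[OF Bc B A sq] .
    then show "inner (blinfun_apply (A - B) x) x = 0"
      by (simp add: blinfun.diff_left inner_diff_left)
  qed
  then show ?thesis by simp
qed

section \<open>Absolute value, parts and uniqueness of the decomposition\<close>

lemma adj_self_adjoint: "self_adjoint S \<Longrightarrow> adj S = S"
  unfolding adj_def self_adjoint_def by (blast intro: the_equality is_adjoint_unique)

text \<open>The cross terms vanish, so K1 + K2 is a positive operator with the same square as K2 -
  K1, and uniqueness of the root identifies it.\<close>

lemma op_abs_compact_diff:
  assumes K: "K1 \<in> compact_ops" "positive_op K1" "K2 \<in> compact_ops" "positive_op K2"
    and K12: "K1 o\<^sub>L K2 = 0"
  shows "op_abs (K2 - K1) = K1 + K2"
proof -
  have sa: "self_adjoint K1" "self_adjoint K2" using K by (simp_all add: positive_op_self_adjoint)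
  have K21: "K2 o\<^sub>L K1 = 0" by (rule self_adjoint_compose_zero_commute[OF sa K12])
  have pos: "positive_op (K1 + K2)"
    using K(2,4) by (simp add: positive_op_iff blinfun.add_left inner_add_left)
  have "blinfun_apply K1 (blinfun_apply K2 x) = 0" "blinfun_apply K2 (blinfun_apply K1 x) = 0" for x
    using arg_cong[OF K12, of "\<lambda>T. blinfun_apply T x"] arg_cong[OF K21, of "\<lambda>T. blinfun_apply T x"]
    by simp_all
  then have sq: "(K1 + K2) o\<^sub>L (K1 + K2) = (K2 - K1) o\<^sub>L (K2 - K1)"
    by (intro blinfun_eqI)
      (simp add: blinfun.add_left blinfun.add_right blinfun.diff_left blinfun.diff_right)
  have "op_abs (K2 - K1) = op_sqrt ((K1 + K2) o\<^sub>L (K1 + K2))"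
    using sa by (simp add: op_abs_def adj_self_adjoint sq)
  also have "\<dots> = K1 + K2"
    unfolding op_sqrt_def
    by (rule the_equality)
      (use pos positive_sqrt_unique[OF compact_ops_add[OF K(1,3)] pos] in auto)
  finally show ?thesis .
qed

lemma compact_decomposition_parts:
  assumes "compact_decomposition T \<alpha> K1 K2"
  shows "pos_part (T - \<alpha> *\<^sub>R id_blinfun) = K2" "neg_part (T - \<alpha> *\<^sub>R id_blinfun) = K1"
proof -
  have K: "K1 \<in> compact_ops" "positive_op K1" "K2 \<in> compact_ops" "positive_op K2" "K1 o\<^sub>L K2 = 0"
    and T: "T = \<alpha> *\<^sub>R id_blinfun - K1 + K2"
    using assms by (simp_all add: compact_decomposition_def)
  have eq: "T - \<alpha> *\<^sub>R id_blinfun = K2 - K1" by (simp add: T)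
  have "K1 + K2 + (K2 - K1) = 2 *\<^sub>R K2" "K1 + K2 - (K2 - K1) = 2 *\<^sub>R K1"
    by (simp_all add: scaleR_2)
  then show "pos_part (T - \<alpha> *\<^sub>R id_blinfun) = K2" "neg_part (T - \<alpha> *\<^sub>R id_blinfun) = K1"
    unfolding eq pos_part_def neg_part_def op_abs_compact_diff[OF K] by simp_all
qed

lemma compact_decomposition_positive:
  assumes "compact_decomposition T \<alpha> K1 K2"
  shows "positive_op T"
proof -
  have K: "positive_op K2" "positive_op (\<alpha> *\<^sub>R id_blinfun - K1)"
    and T: "T = \<alpha> *\<^sub>R id_blinfun - K1 + K2"
    using assms by (simp_all add: compact_decomposition_def op_le_def)
  have "0 \<le> inner (blinfun_apply (\<alpha> *\<^sub>R id_blinfun - K1) x) x + inner (blinfun_apply K2 x) x" for x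
    using positive_op_inner[OF K(1)] positive_op_inner[OF K(2)] by (rule add_nonneg_nonneg[rotated])
  moreover have "self_adjoint T"
    unfolding T using K by (intro self_adjoint_simps positive_op_self_adjoint)
  ultimately show ?thesis
    unfolding positive_op_iff T by (simp add: blinfun.add_left inner_add_left)
qed

text \<open>Two different scalars would make a nonzero multiple of the identity compact, hence small
  on some \<open>perp F\<close> with \<open>F\<close> finite; but that subspace contains a unit
  vector.\<close>

lemma compact_decomposition_scalar_unique:
  fixes T :: "'a::complex_hilbert \<Rightarrow>\<^sub>L 'a"
  assumes inf: "infinite_dimensional TYPE('a)"
    and "compact_decomposition T \<alpha> K1 K2" "compact_decomposition T \<beta> L1 L2"
  shows "\<alpha> = \<beta>"
proof (rule ccontr)
  assume ne: "\<alpha> \<noteq> \<beta>"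
  have K: "K1 \<in> compact_ops" "K2 \<in> compact_ops" "L1 \<in> compact_ops" "L2 \<in> compact_ops"
    and T: "T = \<alpha> *\<^sub>R id_blinfun - K1 + K2" "T = \<beta> *\<^sub>R id_blinfun - L1 + L2"
    using assms by (simp_all add: compact_decomposition_def)
  have "(\<alpha> - \<beta>) *\<^sub>R id_blinfun = (L2 - L1) - (K2 - K1)"
    using T by (simp add: scaleR_diff_left algebra_simps)
  then have "(\<alpha> - \<beta>) *\<^sub>R id_blinfun \<in> (compact_ops :: ('a \<Rightarrow>\<^sub>L 'a) set)"
    using K by (simp add: compact_ops_diff)
  moreover have "self_adjoint ((\<alpha> - \<beta>) *\<^sub>R id_blinfun :: 'a \<Rightarrow>\<^sub>L 'a)" by simp
  moreover have "\<bar>\<alpha> - \<beta>\<bar> / 2 > 0" using ne by simp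
  ultimately obtain F :: "'a set" where F: "finite F"
    "\<forall>x\<in>perp F. norm (blinfun_apply ((\<alpha> - \<beta>) *\<^sub>R id_blinfun) x) \<le> \<bar>\<alpha> - \<beta>\<bar> / 2 * norm x"
    using compact_self_adjoint_small_on_perp by blast
  obtain x where "x \<in> perp F" "norm x = 1" using perp_finite_nonzero[OF inf F(1)] .
  then show False using F(2) ne by (auto simp: blinfun.scaleR_left)
qed

theorem theorem4p2:
  fixes T :: "'a::complex_hilbert \<Rightarrow>\<^sub>L 'a"
  assumes "infinite_dimensional TYPE('a)"
    and "T \<in> bounded_ops"
  shows "(T \<in> closure AN_ops \<and> positive_op T \<longleftrightarrow>
            (\<exists>\<alpha> K\<^sub>1 K\<^sub>2. compact_decomposition T \<alpha> K\<^sub>1 K\<^sub>2)) \<and>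
         (\<forall>\<alpha> K\<^sub>1 K\<^sub>2. compact_decomposition T \<alpha> K\<^sub>1 K\<^sub>2 \<longrightarrow>
            pos_part (T - \<alpha> *\<^sub>R id_blinfun) = K\<^sub>2 \<and>
            neg_part (T - \<alpha> *\<^sub>R id_blinfun) = K\<^sub>1) \<and>
         (\<forall>\<alpha> K\<^sub>1 K\<^sub>2 \<beta> L\<^sub>1 L\<^sub>2.
            compact_decomposition T \<alpha> K\<^sub>1 K\<^sub>2 \<and> compact_decomposition T \<beta> L\<^sub>1 L\<^sub>2 \<longrightarrow>
            \<alpha> = \<beta> \<and> K\<^sub>1 = L\<^sub>1 \<and> K\<^sub>2 = L\<^sub>2)"
proof (intro conjI iffI)
  assume "T \<in> closure AN_ops \<and> positive_op T"
  then have T: "T \<in> closure AN_ops" "positive_op T" by simp_all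
  obtain \<alpha> where \<alpha>: "\<alpha> \<ge> 0" "T - \<alpha> *\<^sub>R id_blinfun \<in> compact_ops"
    using positive_op_in_closure_AN_ops[OF assms(1) T] .
  define K where "K = T - \<alpha> *\<^sub>R id_blinfun"
  have sK: "self_adjoint K" unfolding K_def using positive_op_self_adjoint[OF T(2)] by simp
  \<comment> \<open>Positivity of \<open>T\<close>, read for \<open>K\<close>; the decomposition
    turns it into the condition that K1 is at most \<alpha> I.\<close>
  have lower: "- \<alpha> * (norm x)\<^sup>2 \<le> inner (blinfun_apply K x) x" for x
    using positive_op_inner[OF T(2), of x]
    by (simp add: K_def blinfun.diff_left blinfun.scaleR_left inner_diff_left power2_norm_eq_inner)
  obtain K1 K2 where K12: "K1 \<in> compact_ops" "positive_op K1" "K2 \<in> compact_ops" "positive_op K2"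
    "K = K2 - K1" "K1 o\<^sub>L K2 = 0" "op_le K1 (\<alpha> *\<^sub>R id_blinfun)"
    using compact_self_adjoint_decomposition[OF \<alpha>(2)[folded K_def] sK lower \<alpha>(1)] .
  have "T = \<alpha> *\<^sub>R id_blinfun - K1 + K2" using K12(5) by (simp add: K_def algebra_simps)
  then have "compact_decomposition T \<alpha> K1 K2"
    using \<alpha>(1) K12 by (simp add: compact_decomposition_def)
  then show "\<exists>\<alpha> K\<^sub>1 K\<^sub>2. compact_decomposition T \<alpha> K\<^sub>1 K\<^sub>2" by blast
next
  assume "\<exists>\<alpha> K\<^sub>1 K\<^sub>2. compact_decomposition T \<alpha> K\<^sub>1 K\<^sub>2"
  then show "T \<in> closure AN_ops" "positive_op T"
    using compact_decomposition_in_closure_AN_ops compact_decomposition_positive by blast+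
next
  show "\<forall>\<alpha> K\<^sub>1 K\<^sub>2. compact_decomposition T \<alpha> K\<^sub>1 K\<^sub>2 \<longrightarrow>
      pos_part (T - \<alpha> *\<^sub>R id_blinfun) = K\<^sub>2 \<and> neg_part (T - \<alpha> *\<^sub>R id_blinfun) = K\<^sub>1"
    using compact_decomposition_parts by blast
next
  show "\<forall>\<alpha> K\<^sub>1 K\<^sub>2 \<beta> L\<^sub>1 L\<^sub>2.
      compact_decomposition T \<alpha> K\<^sub>1 K\<^sub>2 \<and> compact_decomposition T \<beta> L\<^sub>1 L\<^sub>2 \<longrightarrow>
      \<alpha> = \<beta> \<and> K\<^sub>1 = L\<^sub>1 \<and> K\<^sub>2 = L\<^sub>2"
  proof (intro allI impI)
    fix \<alpha> K\<^sub>1 K\<^sub>2 \<beta> L\<^sub>1 L\<^sub>2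
    assume d: "compact_decomposition T \<alpha> K\<^sub>1 K\<^sub>2 \<and> compact_decomposition T \<beta> L\<^sub>1 L\<^sub>2"
    then have "\<alpha> = \<beta>" using compact_decomposition_scalar_unique[OF assms(1)] by blast
    then show "\<alpha> = \<beta> \<and> K\<^sub>1 = L\<^sub>1 \<and> K\<^sub>2 = L\<^sub>2" using d compact_decomposition_parts by metis
  qed
qed

end
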